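(* NLimInf is reducible to PosLimInf, and PosLimInf is reducible to AsLimInf; moreover both inclusions are strict: PosLimInf is not reducible to NLimInf, and AsLimInf is not reducible to PosLimInf.
   Context: A probabilistic weighted automaton over a finite alphabet $\Sigma$ is a tuple $A=(Q,\rho_I,\Sigma,\delta,\gamma)$ where $Q$ is a finite set of states, $\rho_I$ is a probability distribution on $Q$, $\delta:Q\times\Sigma\to\mathcal D(Q)$ assigns to each state and letter a probability distribution on $Q$, and $\gamma:Q\times\Sigma\times Q\to\mathbb Q$ is a weight function. A run over an infinite word $w=\sigma_1\sigma_2\dots$ is a sequence $r=q_0\sigma_1q_1\sigma_2\dots$ with $\rho_I(q_0)>0$ and $\delta(q_i,\sigma_{i+1})(q_{i+1})>0$ for all $i$; its weight sequence is $\gamma(r)=v_0v_1\dots$ with $v_i=\gamma(q_i,\sigma_{i+1},q_{i+1})$. For each $w$, the probabilities of finite run prefixes $\rho_I(q_0)\prod_{i=1}^k\delta(q_{i-1},\sigma_i)(q_i)$ induce a probability measure $\mathbb P^A$ on runs over $w$. For a value function $\mathrm{Val}$, the positive semantics is $L^{>0}_A(w)=\sup\{\eta\mid \mathbb P^A(\{r:\mathrm{Val}(\gamma(r))\ge\eta\})>0\}$ and the almost-sure semantics is $L^{=1}_A(w)=\sup\{\eta\mid \mathbb P^A(\{r:\mathrm{Val}(\gamma(r))\ge\eta\})=1\}$. Ignoring probabilities (initial states are those with $\rho_I(q)>0$, transitions those with $\delta(q,\sigma)(q')>0$) gives a nondeterministic automaton with language $L^{\max}_A(w)=\sup\{\mathrm{Val}(\gamma(r))\mid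 r\text{ run over }w\}$. Here $\mathsf{LimInf}(v)=\liminf_{n\to\infty}v_n$. NLimInf, PosLimInf, AsLimInf denote the classes of $\mathsf{LimInf}$-automata under nondeterministic, positive, and almost-sure semantics. A class $\mathcal C$ is reducible to $\mathcal C'$ if for every $A\in\mathcal C$ there is $A'\in\mathcal C'$ over the same alphabet defining the same quantitative language $\Sigma^\omega\to\mathbb R$. *)

theory Defs
  imports "HOL-Probability.Probability"
begin

text \<open>Probabilistic weighted automata. States are natural numbers (any finite state
set is isomorphic to a finite set of naturals); the letters have type 'a, the
alphabet is a finite set of letters. Infinite words are sequences w :: nat => 'a,
w 0 being the first letter sigma_1. A run is a state sequence r :: nat => nat,
r 0 being q_0.\<close>

record 'a pwa =
  states :: "nat set"
  init   :: "nat pmf"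
  trans  :: "nat \<Rightarrow> 'a \<Rightarrow> nat pmf"
  weight :: "nat \<Rightarrow> 'a \<Rightarrow> nat \<Rightarrow> rat"

definition wf_pwa :: "'a set \<Rightarrow> 'a pwa \<Rightarrow> bool" where
  "wf_pwa \<Sigma> A \<longleftrightarrow> finite (states A) \<and> set_pmf (init A) \<subseteq> states A \<and>
     (\<forall>q\<in>states A. \<forall>\<sigma>\<in>\<Sigma>. set_pmf (trans A q \<sigma>) \<subseteq> states A)"

definition is_word :: "'a set \<Rightarrow> (nat \<Rightarrow> 'a) \<Rightarrow> bool" where
  "is_word \<Sigma> w \<longleftrightarrow> (\<forall>i. w i \<in> \<Sigma>)"

definition is_run :: "'a pwa \<Rightarrow> (nat \<Rightarrow> 'a) \<Rightarrow> (nat \<Rightarrow> nat) \<Rightarrow> bool" where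
  "is_run A w r \<longleftrightarrow> pmf (init A) (r 0) > 0 \<and>
     (\<forall>i. pmf (trans A (r i) (w i)) (r (Suc i)) > 0)"

definition liminf_val :: "'a pwa \<Rightarrow> (nat \<Rightarrow> 'a) \<Rightarrow> (nat \<Rightarrow> nat) \<Rightarrow> real" where
  "liminf_val A w r =
     real_of_ereal (liminf (\<lambda>n. ereal (real_of_rat (weight A (r n) (w n) (r (Suc n))))))"

definition run_space :: "(nat \<Rightarrow> nat) measure" where
  "run_space = PiM UNIV (\<lambda>_. count_space UNIV)"

definition run_measure :: "'a pwa \<Rightarrow> (nat \<Rightarrow> 'a) \<Rightarrow> (nat \<Rightarrow> nat) measure" where
  "run_measure A w = (THE M. sets M = sets run_space \<and> prob_space M \<and>
     (\<forall>k s. emeasure M {r \<in> space M. \<forall>i\<le>k. r i = s i} =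
        ennreal (pmf (init A) (s 0) * (\<Prod>i<k. pmf (trans A (s i) (w i)) (s (Suc i))))))"

definition pos_sem :: "'a pwa \<Rightarrow> (nat \<Rightarrow> 'a) \<Rightarrow> real" where
  "pos_sem A w = Sup {\<eta>. emeasure (run_measure A w)
      {r \<in> space (run_measure A w). \<eta> \<le> liminf_val A w r} > 0}"

definition as_sem :: "'a pwa \<Rightarrow> (nat \<Rightarrow> 'a) \<Rightarrow> real" where
  "as_sem A w = Sup {\<eta>. emeasure (run_measure A w)
      {r \<in> space (run_measure A w). \<eta> \<le> liminf_val A w r} = 1}"

definition max_sem :: "'a pwa \<Rightarrow> (nat \<Rightarrow> 'a) \<Rightarrow> real" where
  "max_sem A w = Sup {liminf_val A w r | r. is_run A w r}"

definition reducible ::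
  "'a set \<Rightarrow> ('a pwa \<Rightarrow> (nat \<Rightarrow> 'a) \<Rightarrow> real) \<Rightarrow> ('a pwa \<Rightarrow> (nat \<Rightarrow> 'a) \<Rightarrow> real) \<Rightarrow> bool" where
  "reducible \<Sigma> S S' \<longleftrightarrow> (\<forall>A. wf_pwa \<Sigma> A \<longrightarrow>
     (\<exists>A'. wf_pwa \<Sigma> A' \<and> (\<forall>w. is_word \<Sigma> w \<longrightarrow> S A w = S' A' w)))"

end

theory Submission
  imports Defs
begin

text \<open>
  All probabilistic arguments rest on one fact about a finite-state chain: if from some reachable state
  the probability of staying safe (of never making a bad step) is positive, then at every late enough
  time some reachable state is safe with probability close to 1.

  Values are decomposed into thresholds: the language is a minimum, over the finitely many weights \<open>u\<close>,
  of functions testing whether the value exceeds \<open>u\<close>, and the almost-sure semantics is closed under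
  minima by products. For the nondeterministic semantics the test is made by the deterministic
  breakpoint automaton. For the positive semantics it is made by simulating a run and restarting it in a
  random reachable state after every weight that is at most \<open>u\<close>: by the fact above, restarts
  eventually succeed with probability bounded away from 0, so almost surely there are only finitely many.

  For strictness: that \<open>\<Prod>\<^sub>i (1 - (1/2)^k\<^sub>i)\<close> is positive, where \<open>k\<^sub>i\<close> are the lengths of the successive
  blocks of a word, is tested by a positive automaton; it can hold if the \<open>k\<^sub>i\<close> grow, but fails for the
  periodic words obtained by pumping. And a positive automaton cannot test for infinitely many letters 0,
  since on a long enough block without this letter all its probabilities of staying safe drop below 1/2.
\<close>

section \<open>Path measures of inhomogeneous Markov chains\<close>

text \<open>The restarts need a success probability bounded below uniformly in time. Positivity
  alone provides just one reachable state with positive safety, and the safety available at later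
  times might shrink, so that restarts could go on forever. Once some reachable state is safe with
  probability above 1/2, a uniformly chosen reachable state succeeds with probability at least
  1/(2|Q|), whatever the time, and the number of restarts has a geometric tail. If no reachable
  state is ever safe with positive probability, every simulation fails almost surely. The test thus
  succeeds with probability 0 or 1. One restart rule serves one threshold, hence the decomposition.
  In the nondeterministic case a good run may have probability 0, so random guessing of runs does
  not help; determinism makes positive and almost-sure semantics coincide, so minima have to be
  treated only for the latter. The convergence to 1 also drives both separations: it forces safety
  near 1 at all late times, which periodicity or long constant blocks contradict.\<close>

text \<open>The chain is realised on a product of independent choices: \<open>\<omega> (0, _)\<close> is the initial state and
  \<open>\<omega> (Suc n, x)\<close> the successor chosen at time \<open>n\<close> if the chain is then in state \<open>x\<close>.\<close>

primrec sample_path :: "(nat \<times> 's \<Rightarrow> 's) \<Rightarrow> nat \<Rightarrow> 's" where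
  "sample_path \<omega> 0 = \<omega> (0, undefined)"
| "sample_path \<omega> (Suc n) = \<omega> (Suc n, sample_path \<omega> n)"

definition chain_source :: "'s pmf \<Rightarrow> (nat \<Rightarrow> 's \<Rightarrow> 's pmf) \<Rightarrow> (nat \<times> 's \<Rightarrow> 's) measure" where
  "chain_source \<mu> K =
     PiM UNIV (\<lambda>(i, x). measure_pmf (case i of 0 \<Rightarrow> \<mu> | Suc n \<Rightarrow> K n x))"

abbreviation path_space :: "(nat \<Rightarrow> 's) measure" where
  "path_space \<equiv> PiM UNIV (\<lambda>_. count_space UNIV)"

definition chain :: "'s::countable pmf \<Rightarrow> (nat \<Rightarrow> 's \<Rightarrow> 's pmf) \<Rightarrow> (nat \<Rightarrow> 's) measure" where
  "chain \<mu> K = distr (chain_source \<mu> K) path_space sample_path"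

lemma sets_chain_source:
  "sets (chain_source \<mu> K) = sets (PiM UNIV (\<lambda>_. count_space UNIV))"
  unfolding chain_source_def by (intro sets_PiM_cong) auto

lemma measurable_sample_path [measurable]:
  "(sample_path :: (nat \<times> 's \<Rightarrow> 's::countable) \<Rightarrow> _) \<in> chain_source \<mu> K \<rightarrow>\<^sub>M path_space"
proof -
  have meas: "(\<lambda>\<omega>. sample_path \<omega> n) \<in>
      PiM UNIV (\<lambda>_. count_space UNIV) \<rightarrow>\<^sub>M count_space (UNIV :: 's set)" for n
  proof (induction n)
    case (Suc n)
    \<comment> \<open>The index of the next choice is itself random. With countably many states one
      may split over its value; the redex of the form \<open>f (g r) r\<close> prepares this for
      \<open>measurable_compose_countable\<close>.\<close>
    have "(\<lambda>\<omega>. (\<lambda>x \<omega>. \<omega> (Suc n, x)) (sample_path \<omega> n) \<omega>) \<in>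
        PiM UNIV (\<lambda>_. count_space UNIV) \<rightarrow>\<^sub>M count_space (UNIV :: 's set)"
      by (rule measurable_compose_countable[OF _ Suc]) simp
    then show ?case by simp
  qed simp
  show ?thesis
    by (subst measurable_cong_sets[OF sets_chain_source refl], rule measurable_PiM_single')
       (use meas in \<open>auto simp: PiE_def extensional_def\<close>)
qed

lemma prob_space_chain: "prob_space (chain \<mu> K)"
  unfolding chain_def
proof (rule prob_space.prob_space_distr)
  show "prob_space (chain_source \<mu> K)"
    unfolding chain_source_def by (rule prob_space_PiM) (auto simp: measure_pmf.prob_space_axioms split: prod.split)
qed measurable

lemma sets_chain [measurable_cong, simp]: "sets (chain \<mu> K) = sets path_space"
  by (simp add: chain_def)

lemma space_path_space [simp]: "space path_space = UNIV"
  by (auto simp: space_PiM)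

lemma space_chain [simp]: "space (chain \<mu> K) = UNIV"
  by (simp add: chain_def)

lemma emeasure_chain_UNIV [simp]: "emeasure (chain \<mu> K) UNIV = 1"
  using prob_space.emeasure_space_1[OF prob_space_chain] by (metis space_chain)

lemma UNIV_in_path_space [simp, measurable]: "UNIV \<in> sets path_space"
  using sets.top[of path_space] by simp

lemma measurable_prefix:
  "(\<lambda>r. map r [0..<n]) \<in> path_space \<rightarrow>\<^sub>M count_space (UNIV :: 's::countable list set)"
proof (induction n)
  case (Suc n)
  have "(\<lambda>r. (\<lambda>xs r. xs @ [r n]) (map r [0..<n]) r) \<in>
     path_space \<rightarrow>\<^sub>M count_space (UNIV :: 's::countable list set)"
    by (rule measurable_compose_countable[OF _ Suc]) simp
  then show ?case by simp
qed simp

lemma pred_step [measurable]: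
  "Measurable.pred path_space (\<lambda>r :: nat \<Rightarrow> 's::countable. P (r i) (r j))"
proof -
  have "Measurable.pred path_space (\<lambda>r :: nat \<Rightarrow> 's. (\<lambda>x r. P x (r j)) (r i) r)"
    by (rule measurable_compose_countable) simp_all
  then show ?thesis by simp
qed

lemma Collect_in_path_space: "Measurable.pred path_space P \<Longrightarrow> {r. P r} \<in> sets path_space"
  by (simp add: pred_def)

lemma pred_state [measurable]: "Measurable.pred path_space (\<lambda>r :: nat \<Rightarrow> 's::countable. P (r i))"
  using pred_step[of "\<lambda>x _. P x" i i] .

lemma paths_measurable [measurable]:
  "Measurable.pred path_space (\<lambda>r. \<forall>i\<le>(k::nat). r i = (s i :: 's::countable))"
  by measurable

lemma paths_eq_lists: "{r. \<forall>i\<le>k. r i = s i} = (\<lambda>r. map r [0..<Suc k]) -` {map s [0..<Suc k]}"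
  by (auto simp: less_Suc_eq_le simp del: upt_Suc)

text \<open>With countably many states, every event on the first \<open>k + 1\<close> states is a
  countable union of exact prefixes. Prefixes are the events whose probabilities
  \<open>run_measure\<close> prescribes.\<close>

lemma path_measure_eqI:
  fixes M N :: "(nat \<Rightarrow> 's::countable) measure"
  assumes sets: "sets M = sets path_space" "sets N = sets path_space"
    and fin: "finite_measure M"
    and eq: "\<And>k s. emeasure M {r. \<forall>i\<le>k. r i = s i} = emeasure N {r. \<forall>i\<le>k. r i = s i}"
  shows "M = N"
proof (rule measure_eqI_PiM_infinite[OF sets])
  have sp: "space M = UNIV" "space N = UNIV"
    using sets_eq_imp_space_eq[OF sets(1)] sets_eq_imp_space_eq[OF sets(2)] by auto
  fix A :: "nat \<Rightarrow> 's set" and J :: "nat set"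
  assume J: "finite J"
  \<comment> \<open>The index set is enlarged to an initial segment; inserting 0 covers the empty
    index set.\<close>
  define k where "k = Max (insert 0 J)"
  have Jk: "J \<subseteq> {..k}" using J unfolding k_def by auto
  let ?f = "\<lambda>r :: nat \<Rightarrow> 's. map r [0..<Suc k]"
  have [measurable]: "?f \<in> M \<rightarrow>\<^sub>M count_space UNIV" "?f \<in> N \<rightarrow>\<^sub>M count_space UNIV"
    using measurable_prefix[of "Suc k"] measurable_cong_sets[OF sets(1) refl] measurable_cong_sets[OF sets(2) refl]
    by blast+
  have single: "emeasure M (?f -` {xs}) = emeasure N (?f -` {xs})" for xs
  proof (cases "length xs = Suc k")
    case True
    then have "xs = map (\<lambda>i. xs ! i) [0..<Suc k]" by (metis map_nth)
    then have "?f -` {xs} = {r. \<forall>i\<le>k. r i = xs ! i}"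
      using paths_eq_lists[of k "\<lambda>i. xs ! i"] by simp
    then show ?thesis by (simp only: eq)
  next
    case False
    then have "?f -` {xs} = {}" by auto
    then show ?thesis by simp
  qed
  have "distr M (count_space UNIV) ?f = distr N (count_space UNIV) ?f"
    by (rule measure_eqI_countable[where A=UNIV])
       (simp_all add: emeasure_distr sp single del: upt_Suc)
  then have *: "emeasure M (?f -` X) = emeasure N (?f -` X)" for X
    using emeasure_distr[of ?f M "count_space UNIV" X] emeasure_distr[of ?f N "count_space UNIV" X]
    by (simp add: sp del: upt_Suc)
  have "prod_emb UNIV (\<lambda>_. count_space UNIV) J (Pi\<^sub>E J A) = ?f -` {xs. \<forall>j\<in>J. xs ! j \<in> A j}"
    using Jk by (auto simp: prod_emb_iff less_Suc_eq_le PiE_iff subset_iff simp del: upt_Suc)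
  then show "emeasure M (prod_emb UNIV (\<lambda>_. count_space UNIV) J (Pi\<^sub>E J A)) =
        emeasure N (prod_emb UNIV (\<lambda>_. count_space UNIV) J (Pi\<^sub>E J A))"
    by (simp only: *)
qed (rule fin)

text \<open>The path follows \<open>s\<close> up to time \<open>k\<close> iff the choices stored
  under the \<open>k + 1\<close> keys met along \<open>s\<close> have the right values. The keys
  differ in their time component, so these choices are independent.\<close>

lemma emeasure_chain_cylinder:
  "emeasure (chain \<mu> K) {r. \<forall>i\<le>k. r i = s i} =
     ennreal (pmf \<mu> (s 0) * (\<Prod>i<k. pmf (K i (s i)) (s (Suc i))))"
proof -
  let ?M = "\<lambda>(i, x). measure_pmf (case i of 0 \<Rightarrow> \<mu> | Suc n \<Rightarrow> K n x)"
  interpret product_prob_space ?M UNIV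
    by (rule product_prob_spaceI) (auto simp: measure_pmf.prob_space_axioms split: prod.split)
  let ?key = "\<lambda>i. (i, case i of 0 \<Rightarrow> undefined | Suc n \<Rightarrow> s n)"
  have path: "(\<forall>i\<le>k. sample_path \<omega> i = s i) \<longleftrightarrow> (\<forall>i\<le>k. \<omega> (?key i) = s i)" for \<omega>
  proof (induction k)
    case (Suc k)
    then show ?case by (auto simp: le_Suc_eq all_conj_distrib)
  qed simp
  have inj: "inj_on ?key {..k}" by (auto simp: inj_on_def)
  have "emeasure (chain \<mu> K) {r. \<forall>i\<le>k. r i = s i} =
      emeasure (Pi\<^sub>M UNIV ?M) {\<omega>\<in>space (Pi\<^sub>M UNIV ?M). \<forall>j\<in>?key ` {..k}. \<omega> j \<in> {s (fst j)}}"
  proof -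
    have "{r. \<forall>i\<le>k. r i = s i} \<in> sets path_space"
      using paths_measurable[of k s] by (simp add: pred_def)
    then have "emeasure (chain \<mu> K) {r. \<forall>i\<le>k. r i = s i} =
        emeasure (chain_source \<mu> K) (sample_path -` {r. \<forall>i\<le>k. r i = s i} \<inter> space (chain_source \<mu> K))"
      unfolding chain_def by (intro emeasure_distr) simp_all
    also have "sample_path -` {r. \<forall>i\<le>k. r i = s i} \<inter> space (chain_source \<mu> K) =
        {\<omega>\<in>space (Pi\<^sub>M UNIV ?M). \<forall>j\<in>?key ` {..k}. \<omega> j \<in> {s (fst j)}}"
      using path by (auto simp: chain_source_def)
    finally show ?thesis by (simp only: chain_source_def)
  qed
  also have "\<dots> = (\<Prod>j\<in>?key ` {..k}. emeasure (?M j) {s (fst j)})"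
    by (rule emeasure_PiM_Collect) (auto split: prod.split)
  also have "\<dots> = (\<Prod>i\<le>k. emeasure (?M (?key i)) {s i})"
    by (subst prod.reindex[OF inj]) simp
  also have "\<dots> = (\<Prod>i\<le>k. ennreal (pmf (case i of 0 \<Rightarrow> \<mu> | Suc n \<Rightarrow> K n (s n)) (s i)))"
    by (intro prod.cong) (auto simp: emeasure_pmf_single split: nat.split)
  also have "\<dots> = ennreal (\<Prod>i\<le>k. pmf (case i of 0 \<Rightarrow> \<mu> | Suc n \<Rightarrow> K n (s n)) (s i))"
    by (rule prod_ennreal) simp
  also have "(\<Prod>i\<le>k. pmf (case i of 0 \<Rightarrow> \<mu> | Suc n \<Rightarrow> K n (s n)) (s i)) =
     pmf \<mu> (s 0) * (\<Prod>i<k. pmf (K i (s i)) (s (Suc i)))"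
    by (subst prod.atMost_shift) simp
  finally show ?thesis .
qed

lemma chain_eqI:
  assumes "sets M = sets path_space" "prob_space M"
    and "\<And>k s. emeasure M {r. \<forall>i\<le>k. r i = s i} =
      ennreal (pmf \<mu> (s 0) * (\<Prod>i<k. pmf (K i (s i)) (s (Suc i))))"
  shows "M = chain \<mu> K"
  using assms by (intro path_measure_eqI) (auto simp: emeasure_chain_cylinder prob_space_def)

text \<open>\<open>run_measure\<close> is a definite description: the construction supplies
  existence, and the cylinder probabilities supply uniqueness.\<close>

lemma run_measure_eq_chain: "run_measure A w = chain (init A) (\<lambda>i q. trans A q (w i))"
  unfolding run_measure_def
proof (rule the_equality)
  fix M assume M: "sets M = sets run_space \<and> prob_space M \<and>
     (\<forall>k s. emeasure M {r \<in> space M. \<forall>i\<le>k. r i = s i} =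
        ennreal (pmf (init A) (s 0) * (\<Prod>i<k. pmf (trans A (s i) (w i)) (s (Suc i)))))"
  then have "space M = UNIV" using sets_eq_imp_space_eq[of M run_space] by (simp add: run_space_def)
  with M show "M = chain (init A) (\<lambda>i q. trans A q (w i))"
    by (intro chain_eqI) (auto simp: run_space_def)
qed (simp add: run_space_def prob_space_chain emeasure_chain_cylinder)

section \<open>The Markov property: conditioning on the first step\<close>

lemma measurable_case_nat_path [measurable]:
  "(case_nat q :: (nat \<Rightarrow> 's) \<Rightarrow> _) \<in> path_space \<rightarrow>\<^sub>M path_space"
proof (rule measurable_PiM_single')
  show "(\<lambda>\<omega>. case_nat q \<omega> i) \<in> path_space \<rightarrow>\<^sub>M count_space (UNIV :: 's set)" for i
    by (cases i) auto
qed auto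

text \<open>The mixture over \<open>q\<close> of the chains started with law \<open>K 0 q\<close>,
  each path prefixed by \<open>q\<close>, has the same cylinder probabilities as the chain and hence
  equals it.\<close>

lemma emeasure_chain_step:
  assumes [measurable]: "E \<in> sets path_space"
  shows "emeasure (chain \<mu> K) E =
    (\<integral>\<^sup>+q. emeasure (chain (K 0 q) (\<lambda>i. K (Suc i))) {r. case_nat q r \<in> E} \<partial>\<mu>)"
proof -
  let ?C = "\<lambda>q. chain (K 0 q) (\<lambda>i. K (Suc i))"
  let ?D = "\<lambda>q. distr (?C q) path_space (case_nat q)"
  let ?B = "measure_pmf \<mu> \<bind> ?D"
  have D: "?D \<in> measure_pmf \<mu> \<rightarrow>\<^sub>M subprob_algebra path_space"
    by (auto simp: space_subprob_algebra intro!: prob_space_imp_subprob_space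
        prob_space.prob_space_distr prob_space_chain)
  have em: "emeasure ?B X = (\<integral>\<^sup>+q. emeasure (?C q) {r. case_nat q r \<in> X} \<partial>\<mu>)"
    if "X \<in> sets path_space" for X
    using that by (subst emeasure_bind[OF _ D]) (auto simp: emeasure_distr vimage_def)
  have "?B = chain \<mu> K"
  proof (rule chain_eqI)
    show sB: "sets ?B = sets path_space" by (rule sets_bind) auto
    have "emeasure ?B UNIV = 1"
      by (subst em) simp_all
    then show "prob_space ?B"
      using sets_eq_imp_space_eq[OF sB] by (intro prob_spaceI) auto
    fix k and s :: "nat \<Rightarrow> 'a"
    have "emeasure (?C q) {r. case_nat q r \<in> {r. \<forall>i\<le>k. r i = s i}} =
        ennreal (\<Prod>i<k. pmf (K i (s i)) (s (Suc i))) * indicator {s 0} q" for q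
    proof (cases "q = s 0")
      case True
      show ?thesis
      proof (cases k)
        case 0
        with True show ?thesis
          by simp
      next
        case (Suc k')
        have "(\<forall>i\<le>k. case_nat q r i = s i) \<longleftrightarrow> (\<forall>i\<le>k'. r i = s (Suc i))" for r
          using True Suc by (metis Suc_le_mono le0 nat.case(1) nat.case(2) not0_implies_Suc)
        then have "{r. case_nat q r \<in> {r. \<forall>i\<le>k. r i = s i}} = {r. \<forall>i\<le>k'. r i = s (Suc i)}"
          by simp
        then show ?thesis using True Suc
          by (simp only: emeasure_chain_cylinder prod.lessThan_Suc_shift) simp
      qed
    next
      case False
      then have "{r. case_nat q r \<in> {r. \<forall>i\<le>k. r i = s i}} = {}"
        by (auto dest: spec[of _ 0])
      then show ?thesis using False by (simp only:) simp
    qed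
    then show "emeasure ?B {r. \<forall>i\<le>k. r i = s i} =
      ennreal (pmf \<mu> (s 0) * (\<Prod>i<k. pmf (K i (s i)) (s (Suc i))))"
      using paths_measurable[of k s]
      by (subst em) (simp_all add: nn_integral_multc emeasure_pmf_single ennreal_mult prod_nonneg
          mult.commute Collect_in_path_space)
  qed
  with em[OF assms] show ?thesis by simp
qed

lemma measure_chain_step:
  assumes E: "E \<in> sets path_space"
  shows "measure (chain \<mu> K) E =
    (\<integral>q. measure (chain (K 0 q) (\<lambda>i. K (Suc i))) {r. case_nat q r \<in> E} \<partial>\<mu>)"
proof -
  have fin: "emeasure (chain m L) X = ennreal (measure (chain m L) X)" for m L and X :: "(nat \<Rightarrow> 'a) set"
    by (simp add: finite_measure.emeasure_eq_measure prob_space.finite_measure prob_space_chain)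
  have "ennreal (measure (chain \<mu> K) E) =
     (\<integral>\<^sup>+q. ennreal (measure (chain (K 0 q) (\<lambda>i. K (Suc i))) {r. case_nat q r \<in> E}) \<partial>\<mu>)"
    using emeasure_chain_step[OF E] by (simp add: fin)
  also have "\<dots> = ennreal (\<integral>q. measure (chain (K 0 q) (\<lambda>i. K (Suc i))) {r. case_nat q r \<in> E} \<partial>\<mu>)"
    by (intro nn_integral_eq_integral measure_pmf.integrable_const_bound[where B=1])
       (auto simp: prob_space.prob_le_1[OF prob_space_chain])
  finally show ?thesis by (simp add: integral_nonneg_AE)
qed

definition chain_from :: "(nat \<Rightarrow> 's \<Rightarrow> 's pmf) \<Rightarrow> nat \<Rightarrow> 's::countable \<Rightarrow> (nat \<Rightarrow> 's) measure" where
  "chain_from K n q = chain (return_pmf q) (\<lambda>i. K (n + i))"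

lemma prob_space_chain_from: "prob_space (chain_from K n q)"
  by (simp add: chain_from_def prob_space_chain)

lemma sets_chain_from [measurable_cong, simp]: "sets (chain_from K n q) = sets path_space"
  by (simp add: chain_from_def)

lemma space_chain_from [simp]: "space (chain_from K n q) = UNIV"
  by (simp add: chain_from_def)

lemma measure_chain_eq_integral:
  assumes E: "E \<in> sets path_space"
  shows "measure (chain \<mu> K) E = (\<integral>q. measure (chain_from K 0 q) E \<partial>\<mu>)"
  using measure_chain_step[OF E, of \<mu> K] measure_chain_step[OF E, of "return_pmf _" K]
  by (simp add: chain_from_def)

lemma AE_chain_from_start: "AE r in chain_from K n q. r 0 = q"
proof (subst prob_space.AE_iff_emeasure_eq_1[OF prob_space_chain_from])
  show "emeasure (chain_from K n q) {r \<in> space (chain_from K n q). r 0 = q} = 1"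
    using emeasure_chain_cylinder[of "return_pmf q" "\<lambda>i. K (n + i)" 0 "\<lambda>_. q"]
    by (simp add: chain_from_def)
qed (simp, measurable)

lemma chain_from_start_cong:
  assumes "\<And>r. r 0 = q \<Longrightarrow> P r \<longleftrightarrow> Q r"
    and "Measurable.pred path_space P" "Measurable.pred path_space Q"
  shows "measure (chain_from K n q) {r. P r} = measure (chain_from K n q) {r. Q r}"
  using AE_chain_from_start[where K=K and n=n and q=q] assms
  by (intro measure_eq_AE) (auto simp: Collect_in_path_space)

text \<open>The conjunct \<open>r 0 = q'\<close> holds almost surely. It is added so that the
  transition from \<open>q\<close> to \<open>r 0\<close> can be evaluated as one from
  \<open>q\<close> to \<open>q'\<close> when the integrand is simplified.\<close>

lemma measure_chain_from_step:
  assumes [measurable]: "Measurable.pred path_space Q"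
  shows "measure (chain_from K n q) {r. Q r} =
    (\<integral>q'. measure (chain_from K (Suc n) q') {r. r 0 = q' \<and> Q (case_nat q r)} \<partial>K n q)"
proof -
  have E: "{r. Q r} \<in> sets path_space" using assms by (simp add: pred_def)
  then have "measure (chain_from K n q) {r. Q r} =
      measure (chain (K n q) (\<lambda>i. K (Suc n + i))) {r. Q (case_nat q r)}"
    by (simp add: chain_from_def measure_chain_step)
  also have "\<dots> = (\<integral>q'. measure (chain_from K (Suc n) q') {r. Q (case_nat q r)} \<partial>K n q)"
    by (subst measure_chain_eq_integral) (simp_all add: chain_from_def Collect_in_path_space)
  also have "(\<lambda>q'. measure (chain_from K (Suc n) q') {r. Q (case_nat q r)}) = (\<lambda>q'.
      measure (chain_from K (Suc n) q') {r. r 0 = q' \<and> Q (case_nat q r)})"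
  proof
    fix q'
    show "measure (chain_from K (Suc n) q') {r. Q (case_nat q r)} =
        measure (chain_from K (Suc n) q') {r. r 0 = q' \<and> Q (case_nat q r)}"
      using AE_chain_from_start[where K=K and n="Suc n" and q=q']
      by (intro measure_eq_AE) (auto intro!: Collect_in_path_space)
  qed
  finally show ?thesis .
qed

lemma emeasure_chain_image_step:
  fixes f :: "'s::countable \<Rightarrow> 't"
  shows "emeasure (chain \<mu> K) {r. \<forall>i\<le>k. f (r i) = s i} =
     (\<integral>\<^sup>+q. indicator {s 0} (f q) * (case k of 0 \<Rightarrow> 1 | Suc k' \<Rightarrow>
        emeasure (chain (K 0 q) (\<lambda>i. K (Suc i))) {r. \<forall>i\<le>k'. f (r i) = s (Suc i)}) \<partial>\<mu>)"
proof -
  have all_split: "(\<forall>i\<le>k. P i) \<longleftrightarrow> P 0 \<and> (case k of 0 \<Rightarrow> True | Suc k' \<Rightarrow> \<forall>i\<le>k'. P (Suc i))" for P and k :: nat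
    by (cases k) (auto, metis Suc_le_mono not0_implies_Suc)
  have "{r. \<forall>i\<le>k. f (r i) = s i} \<in> sets path_space"
    by (rule Collect_in_path_space) measurable
  then have "emeasure (chain \<mu> K) {r. \<forall>i\<le>k. f (r i) = s i} =
    (\<integral>\<^sup>+q. emeasure (chain (K 0 q) (\<lambda>i. K (Suc i))) {r. \<forall>i\<le>k. f (case_nat q r i) = s i} \<partial>\<mu>)"
    by (simp add: emeasure_chain_step)
  also have "\<dots> = (\<integral>\<^sup>+q. indicator {s 0} (f q) * (case k of 0 \<Rightarrow> 1 | Suc k' \<Rightarrow>
      emeasure (chain (K 0 q) (\<lambda>i. K (Suc i))) {r. \<forall>i\<le>k'. f (r i) = s (Suc i)}) \<partial>\<mu>)"
    by (subst all_split) (auto intro!: nn_integral_cong simp: indicator_def split: nat.split)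
  finally show ?thesis .
qed

text \<open>Lumping: by the assumption, the law of the next image depends on the current state only
  through its image. This serves to encode states as numbers and to project a product onto its
  components.\<close>

lemma distr_chain:
  fixes h :: "'s::countable \<Rightarrow> 't::countable"
  assumes K: "\<And>i q. map_pmf h (K i q) = L i (h q)"
  shows "distr (chain \<mu> K) path_space (\<lambda>r i. h (r i)) = chain (map_pmf h \<mu>) L"
proof (rule path_measure_eqI)
  have h [measurable]: "(\<lambda>(r :: nat \<Rightarrow> 's) i. h (r i)) \<in> path_space \<rightarrow>\<^sub>M path_space"
    by (rule measurable_PiM_single') (auto simp: PiE_def extensional_def)
  then show "finite_measure (distr (chain \<mu> K) path_space (\<lambda>r i. h (r i)))"
    by (intro prob_space.finite_measure prob_space.prob_space_distr prob_space_chain) simp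
  have *: "emeasure (chain \<mu> K) {r. \<forall>i\<le>k. h (r i) = s i} = emeasure (chain (map_pmf h \<mu>) L) {r. \<forall>i\<le>k. r i = s i}"
    if "\<And>i q. map_pmf h (K i q) = L i (h q)" for k s \<mu> K L
    using that
  proof (induction k arbitrary: s \<mu> K L)
    case 0
    show ?case
      by (subst emeasure_chain_image_step[where f=h], subst emeasure_chain_image_step[where f="\<lambda>x. x"]) simp
  next
    case (Suc k)
    have "emeasure (chain (K 0 q) (\<lambda>i. K (Suc i))) {r. \<forall>i\<le>k. h (r i) = s (Suc i)} =
       emeasure (chain (L 0 (h q)) (\<lambda>i. L (Suc i))) {r. \<forall>i\<le>k. r i = s (Suc i)}" for q
      using Suc.IH[of "\<lambda>i. K (Suc i)" "\<lambda>i. L (Suc i)" "K 0 q"] Suc.prems by simp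
    then show ?case
      by (subst emeasure_chain_image_step[where f=h], subst emeasure_chain_image_step[where f="\<lambda>x. x"]) simp
  qed
  fix k s
  have "{r :: nat \<Rightarrow> 't. \<forall>i\<le>k. r i = s i} \<in> sets path_space"
    using paths_measurable[of k s] by (simp add: pred_def)
  then show "emeasure (distr (chain \<mu> K) path_space (\<lambda>r i. h (r i))) {r. \<forall>i\<le>k. r i = s i} =
        emeasure (chain (map_pmf h \<mu>) L) {r. \<forall>i\<le>k. r i = s i}"
    using *[of K L \<mu> k s] K by (subst emeasure_distr) (auto simp: vimage_def)
qed simp_all

lemma all_ge_Suc_iff: "(\<forall>i\<ge>Suc N. P i) \<longleftrightarrow> (\<forall>i\<ge>N. P (Suc i))"
  by (metis Suc_le_D Suc_le_mono)

lemma pred_eventually_step [measurable]: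
  fixes P :: "nat \<Rightarrow> 's::countable \<Rightarrow> 's \<Rightarrow> bool"
  shows "Measurable.pred path_space (\<lambda>r. \<forall>\<^sub>F i in sequentially. P i (r i) (r (Suc i)))"
  unfolding eventually_sequentially by measurable

lemma all_nat_iff: "(\<forall>i::nat. P i) \<longleftrightarrow> P 0 \<and> (\<forall>i. P (Suc i))"
  by (metis nat.exhaust)

section \<open>Probabilities of staying safe in a chain with finitely many states\<close>

locale finite_chain =
  fixes K :: "nat \<Rightarrow> 's::countable \<Rightarrow> 's pmf" and St :: "'s set"
    and good :: "nat \<Rightarrow> 's \<Rightarrow> 's \<Rightarrow> bool"
  assumes finite_St: "finite St"
    and K_closed: "q \<in> St \<Longrightarrow> set_pmf (K n q) \<subseteq> St"
begin

definition safe :: "nat \<Rightarrow> 's \<Rightarrow> real" where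
  "safe n q = measure (chain_from K n q) {r. \<forall>i. good (n + i) (r i) (r (Suc i))}"

definition safe_upto :: "nat \<Rightarrow> nat \<Rightarrow> 's \<Rightarrow> real" where
  "safe_upto k n q = measure (chain_from K n q) {r. \<forall>i<k. good (n + i) (r i) (r (Suc i))}"

lemma measure_step_sum:
  assumes q: "q \<in> St" and [measurable]: "Measurable.pred path_space Q"
    and c: "\<And>q'. q' \<in> set_pmf (K n q) \<Longrightarrow>
      measure (chain_from K (Suc n) q') {r. r 0 = q' \<and> Q (case_nat q r)} = c q'"
  shows "measure (chain_from K n q) {r. Q r} = (\<Sum>q'\<in>St. pmf (K n q) q' * c q')"
proof -
  have "measure (chain_from K n q) {r. Q r} = (\<integral>q'. c q' \<partial>K n q)"
    by (subst measure_chain_from_step) (auto intro!: integral_cong_AE simp: AE_measure_pmf_iff c)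
  also have "\<dots> = (\<Sum>q'\<in>St. c q' * pmf (K n q) q')"
    using K_closed[OF q] by (intro integral_measure_pmf_real finite_St) auto
  finally show ?thesis by (simp add: mult.commute)
qed

lemma safe_step:
  assumes q: "q \<in> St"
  shows "safe n q = (\<Sum>q'\<in>St. pmf (K n q) q' * (if good n q q' then safe (Suc n) q' else 0))"
  unfolding safe_def
proof (rule measure_step_sum[OF q])
  fix q'
  have "measure (chain_from K (Suc n) q')
        {r. r 0 = q' \<and> (\<forall>i. good (n + i) (case_nat q r i) (case_nat q r (Suc i)))} =
      measure (chain_from K (Suc n) q') {r. good n q q' \<and> (\<forall>i. good (Suc n + i) (r i) (r (Suc i)))}"
    by (rule chain_from_start_cong) (auto simp: all_nat_iff[where P="\<lambda>i. good (n + i) (case_nat q _ i) (_ i)"])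
  then show "measure (chain_from K (Suc n) q')
        {r. r 0 = q' \<and> (\<forall>i. good (n + i) (case_nat q r i) (case_nat q r (Suc i)))} =
      (if good n q q' then measure (chain_from K (Suc n) q')
         {r. \<forall>i. good (Suc n + i) (r i) (r (Suc i))} else 0)"
    by simp
qed measurable

lemma safe_upto_0 [simp]: "safe_upto 0 n q = 1"
  using prob_space.prob_space[OF prob_space_chain_from, of K n q] by (simp add: safe_upto_def)

lemma safe_upto_Suc:
  assumes q: "q \<in> St"
  shows "safe_upto (Suc k) n q =
    (\<Sum>q'\<in>St. pmf (K n q) q' * (if good n q q' then safe_upto k (Suc n) q' else 0))"
  unfolding safe_upto_def
proof (rule measure_step_sum[OF q])
  fix q'
  have "measure (chain_from K (Suc n) q')
        {r. r 0 = q' \<and> (\<forall>i<Suc k. good (n + i) (case_nat q r i) (case_nat q r (Suc i)))} =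
      measure (chain_from K (Suc n) q') {r. good n q q' \<and> (\<forall>i<k. good (Suc n + i) (r i) (r (Suc i)))}"
    by (rule chain_from_start_cong) (auto simp: All_less_Suc2)
  then show "measure (chain_from K (Suc n) q')
        {r. r 0 = q' \<and> (\<forall>i<Suc k. good (n + i) (case_nat q r i) (case_nat q r (Suc i)))} =
      (if good n q q' then measure (chain_from K (Suc n) q')
         {r. \<forall>i<k. good (Suc n + i) (r i) (r (Suc i))} else 0)"
    by simp
qed measurable

lemma safe_nonneg [simp]: "0 \<le> safe n q" and safe_le_1: "safe n q \<le> 1"
  by (simp_all add: safe_def prob_space.prob_le_1[OF prob_space_chain_from])

lemma safe_upto_tendsto: "(\<lambda>k. safe_upto k n q) \<longlonglongrightarrow> safe n q"
proof -
  interpret prob_space "chain_from K n q" by (rule prob_space_chain_from)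
  have "(\<lambda>k. safe_upto k n q) \<longlonglongrightarrow>
     measure (chain_from K n q) (\<Inter>k. {r. \<forall>i<k. good (n + i) (r i) (r (Suc i))})"
    unfolding safe_upto_def
    by (rule finite_Lim_measure_decseq)
      (auto simp: decseq_def intro!: Collect_in_path_space)
  also have "(\<Inter>k. {r. \<forall>i<k. good (n + i) (r i) (r (Suc i))}) = {r. \<forall>i. good (n + i) (r i) (r (Suc i))}"
    by auto
  finally show ?thesis by (simp add: safe_def)
qed

lemma safe_le_safe_upto: "safe n q \<le> safe_upto k n q"
proof -
  interpret prob_space "chain_from K n q" by (rule prob_space_chain_from)
  show ?thesis unfolding safe_def safe_upto_def
    by (rule finite_measure_mono) (auto intro!: Collect_in_path_space)
qed

primrec reach :: "'s set \<Rightarrow> nat \<Rightarrow> 's set" where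
  "reach S 0 = S"
| "reach S (Suc n) = (\<Union>q\<in>reach S n. set_pmf (K n q))"

lemma reach_subset: "S \<subseteq> St \<Longrightarrow> reach S n \<subseteq> St"
proof (induction n)
  case (Suc n)
  then show ?case using K_closed by (auto dest!: subsetD)
qed simp

lemma reach_nonempty: "S \<noteq> {} \<Longrightarrow> reach S n \<noteq> {}"
  by (induction n) (auto simp: set_pmf_not_empty)

text \<open>Markov property at time \<open>n + k\<close>: after \<open>k\<close> safe steps the
  chain is in a reachable state, from which it stays safe with probability at most \<open>c\<close>.
  Unfolding first steps only avoids conditioning on the state at time \<open>n + k\<close>.\<close>

lemma safe_le_upto_mult:
  assumes S: "S \<subseteq> St" and c: "0 \<le> c"
    and q: "q \<in> reach S n" and le: "\<And>q'. q' \<in> reach S (n + k) \<Longrightarrow> safe (n + k) q' \<le> c"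
  shows "safe n q \<le> safe_upto k n q * c"
  using q le
proof (induction k arbitrary: n q)
  case (Suc k)
  have q: "q \<in> St" using Suc.prems(1) reach_subset[OF S] by auto
  have IH: "safe (Suc n) q' \<le> safe_upto k (Suc n) q' * c" if "q' \<in> set_pmf (K n q)" for q'
    using Suc.prems that by (intro Suc.IH) auto
  have le: "pmf (K n q) q' * safe (Suc n) q' \<le> pmf (K n q) q' * (safe_upto k (Suc n) q' * c)" for q'
    using IH[of q'] by (cases "q' \<in> set_pmf (K n q)") (auto intro!: mult_left_mono simp: set_pmf_iff)
  have "safe n q \<le> (\<Sum>q'\<in>St. pmf (K n q) q' * (if good n q q' then safe_upto k (Suc n) q' * c else 0))"
    unfolding safe_step[OF q] by (intro sum_mono) (use le in auto)
  also have "\<dots> = safe_upto (Suc k) n q * c"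
    by (auto simp: safe_upto_Suc[OF q] sum_distrib_right intro!: sum.cong)
  finally show ?case .
qed simp

text \<open>An elementary substitute for Levy's zero-one law: since the probability of staying safe
  for \<open>k\<close> steps tends to the probability of staying safe forever, the latter, conditioned on the
  former, tends to 1.\<close>

lemma safe_tends_to_1:
  assumes S: "S \<subseteq> St" and q: "q \<in> reach S n" and pos: "safe n q > 0" and c: "c < 1"
  shows "\<exists>N\<ge>n. \<forall>m\<ge>N. \<exists>q'\<in>reach S m. safe m q' > c"
proof -
  \<comment> \<open>The product bound needs a nonnegative factor, while \<open>c\<close> may be
    negative.\<close>
  define d where "d = max c 0"
  have d: "0 \<le> d" "d < 1" "c \<le> d" using c by (auto simp: d_def)
  have "(\<lambda>k. safe_upto k n q * d) \<longlonglongrightarrow> safe n q * d"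
    by (intro tendsto_intros safe_upto_tendsto)
  moreover have "safe n q * d < safe n q" using d pos by simp
  ultimately have "\<forall>\<^sub>F k in sequentially. safe_upto k n q * d < safe n q"
    by (rule order_tendstoD)
  then obtain N where N: "safe_upto k n q * d < safe n q" if "k \<ge> N" for k
    by (auto simp: eventually_sequentially)
  have "\<exists>q'\<in>reach S m. safe m q' > c" if m: "m \<ge> n + N" for m
  proof (rule ccontr)
    assume "\<not> ?thesis"
    then have "\<And>q'. q' \<in> reach S (n + (m - n)) \<Longrightarrow> safe (n + (m - n)) q' \<le> d"
      using m d by force
    from safe_le_upto_mult[OF S d(1) q this] have "safe n q \<le> safe_upto (m - n) n q * d" .
    moreover have "N \<le> m - n" using m by simp
    ultimately show False using N[of "m - n"] by simp
  qed
  then show ?thesis by (intro exI[of _ "n + N"]) auto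
qed

definition ev_safe :: "nat \<Rightarrow> 's \<Rightarrow> real" where
  "ev_safe n q = measure (chain_from K n q) {r. \<forall>\<^sub>F i in sequentially. good (n + i) (r i) (r (Suc i))}"

lemma ev_safe_step:
  assumes q: "q \<in> St"
  shows "ev_safe n q = (\<Sum>q'\<in>St. pmf (K n q) q' * ev_safe (Suc n) q')"
  unfolding ev_safe_def
proof (rule measure_step_sum[OF q])
  fix q'
  have ev: "(\<forall>\<^sub>F i in sequentially. good (n + i) (case_nat q r i) (case_nat q r (Suc i))) \<longleftrightarrow>
     (\<forall>\<^sub>F i in sequentially. good (Suc n + i) (r i) (r (Suc i)))" for r
    by (subst eventually_sequentially_Suc[symmetric]) simp
  show "measure (chain_from K (Suc n) q')
        {r. r 0 = q' \<and> (\<forall>\<^sub>F i in sequentially. good (n + i) (case_nat q r i) (case_nat q r (Suc i)))} =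
      measure (chain_from K (Suc n) q') {r. \<forall>\<^sub>F i in sequentially. good (Suc n + i) (r i) (r (Suc i))}"
    unfolding ev by (rule chain_from_start_cong) (auto intro!: pred_eventually_step pred_intros_logic)
qed measurable

lemma safe_le_ev_safe: "safe n q \<le> ev_safe n q"
proof -
  interpret prob_space "chain_from K n q" by (rule prob_space_chain_from)
  show ?thesis unfolding safe_def ev_safe_def
    by (rule finite_measure_mono) (auto intro!: Collect_in_path_space)
qed

text \<open>Eventual safety is a tail event, so its probability is the average of those at the
  successors, and a positive value at one successor makes the average positive.\<close>

lemma ev_safe_pos_back:
  assumes S: "S \<subseteq> St" and "q \<in> reach S n" "ev_safe n q > 0"
  shows "\<exists>q\<in>S. ev_safe 0 q > 0"
  using assms(2,3)
proof (induction n arbitrary: q)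
  case (Suc n)
  then obtain p where p: "p \<in> reach S n" "q \<in> set_pmf (K n p)" by auto
  then have pS: "p \<in> St" "q \<in> St" using reach_subset[OF S, of n] K_closed[of p n] by auto
  have "0 < pmf (K n p) q * ev_safe (Suc n) q" using Suc.prems p by (simp add: pmf_positive)
  also have "\<dots> \<le> ev_safe n p"
    unfolding ev_safe_step[OF pS(1)] using finite_St pS(2)
    by (intro member_le_sum) (auto simp: ev_safe_def)
  finally show ?case using Suc.IH p by blast
qed auto

text \<open>Eventual safety is the union over \<open>N\<close> of safety from step \<open>N\<close>
  on. Each of these events is null: after \<open>N\<close> steps the chain is in a reachable state,
  where safety has probability 0.\<close>

lemma ev_safe_eq_0:
  assumes S: "S \<subseteq> St" and 0: "\<And>n q. q \<in> reach S n \<Longrightarrow> safe n q = 0" and q: "q \<in> reach S n"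
  shows "ev_safe n q = 0"
proof -
  let ?T = "\<lambda>N n. {r. \<forall>i\<ge>N. good (n + i) (r i) (r (Suc i))}"
  have tail: "measure (chain_from K n q) (?T N n) = 0" if "q \<in> reach S n" for N
    using that
  proof (induction N arbitrary: n q)
    case 0
    then show ?case using assms(2) by (simp add: safe_def)
  next
    case (Suc N)
    have "measure (chain_from K n q) (?T (Suc N) n) = (\<Sum>q'\<in>St. pmf (K n q) q' * 0)"
    proof (rule measure_step_sum)
      show "q \<in> St" using Suc.prems reach_subset[OF S] by auto
      fix q' assume "q' \<in> set_pmf (K n q)"
      then have "measure (chain_from K (Suc n) q') (?T N (Suc n)) = 0"
        using Suc by (intro Suc.IH) auto
      moreover have "(\<forall>i\<ge>Suc N. good (n + i) (case_nat q r i) (case_nat q r (Suc i))) \<longleftrightarrow>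
         (\<forall>i\<ge>N. good (Suc n + i) (r i) (r (Suc i)))" for r
        by (simp add: all_ge_Suc_iff)
      moreover have "measure (chain_from K (Suc n) q')
         {r. r 0 = q' \<and> (\<forall>i\<ge>N. good (Suc n + i) (r i) (r (Suc i)))} =
         measure (chain_from K (Suc n) q') {r. \<forall>i\<ge>N. good (Suc n + i) (r i) (r (Suc i))}"
        by (rule chain_from_start_cong) auto
      ultimately show "measure (chain_from K (Suc n) q')
         {r. r 0 = q' \<and> (\<forall>i\<ge>Suc N. good (n + i) (case_nat q r i) (case_nat q r (Suc i)))} = 0"
        by simp
    qed measurable
    then show ?case by simp
  qed
  interpret prob_space "chain_from K n q" by (rule prob_space_chain_from)
  have "emeasure (chain_from K n q) (\<Union>N. ?T N n) = 0"
    by (rule emeasure_UN_eq_0) (auto simp: emeasure_eq_measure tail[OF q] intro!: Collect_in_path_space)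
  also have "(\<Union>N. ?T N n) = {r. \<forall>\<^sub>F i in sequentially. good (n + i) (r i) (r (Suc i))}"
    by (auto simp: eventually_sequentially)
  finally show ?thesis by (simp add: ev_safe_def measure_def)
qed

lemma measure_chain_eq_sum:
  assumes "set_pmf \<mu> \<subseteq> St" "E \<in> sets path_space"
  shows "measure (chain \<mu> K) E = (\<Sum>q\<in>St. pmf \<mu> q * measure (chain_from K 0 q) E)"
  unfolding measure_chain_eq_integral[OF assms(2)] using assms(1)
  by (subst integral_measure_pmf_real[OF finite_St]) (auto simp: mult.commute)

text \<open>Reduces positivity for the path measure to a single reachable state, from which the
  amplification towards 1 can start.\<close>

theorem ev_safe_pos_iff:
  assumes \<mu>: "set_pmf \<mu> \<subseteq> St"
  shows "measure (chain \<mu> K) {r. \<forall>\<^sub>F i in sequentially. good i (r i) (r (Suc i))} > 0 \<longleftrightarrow>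
    (\<exists>n. \<exists>q\<in>reach (set_pmf \<mu>) n. safe n q > 0)" (is "?L > 0 \<longleftrightarrow> ?R")
proof -
  have "{r. \<forall>\<^sub>F i in sequentially. good i (r i) (r (Suc i))} \<in> sets path_space"
    by (intro Collect_in_path_space pred_eventually_step)
  then have L: "?L = (\<Sum>q\<in>St. pmf \<mu> q * ev_safe 0 q)"
    using measure_chain_eq_sum[OF \<mu>] by (simp add: ev_safe_def)
  show ?thesis
  proof
    assume ?R
    then obtain n q where q: "q \<in> reach (set_pmf \<mu>) n" "safe n q > 0" by auto
    then have "ev_safe n q > 0" using safe_le_ev_safe[of n q] by simp
    then obtain q0 where q0: "q0 \<in> set_pmf \<mu>" "ev_safe 0 q0 > 0"
      using ev_safe_pos_back[OF \<mu> q(1)] by auto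
    then have "0 < pmf \<mu> q0 * ev_safe 0 q0" by (simp add: pmf_positive)
    also have "\<dots> \<le> ?L" unfolding L using finite_St q0(1) \<mu>
      by (intro member_le_sum) (auto simp: ev_safe_def)
    finally show "?L > 0" .
  next
    assume pos: "?L > 0"
    show ?R
    proof (rule ccontr)
      assume neg: "\<not> ?R"
      then have "safe n q = 0" if "q \<in> reach (set_pmf \<mu>) n" for n q
        using that neg safe_nonneg[of n q] by (auto simp: not_less intro: antisym)
      then have "ev_safe 0 q = 0" if "q \<in> set_pmf \<mu>" for q
        using that by (intro ev_safe_eq_0[OF \<mu>]) auto
      then have "?L = 0" unfolding L by (intro sum.neutral) (auto simp: set_pmf_iff)
      with pos show False by simp
    qed
  qed
qed

end

section \<open>Semantics in terms of chains\<close>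

context finite_chain begin

lemma AE_chain_in_states:
  assumes \<mu>: "set_pmf \<mu> \<subseteq> St"
  shows "AE r in chain \<mu> K. \<forall>i. r i \<in> St"
proof -
  \<comment> \<open>Paths range over all sequences of the type, so confinement to \<open>St\<close>
    has to be proved almost surely. It is itself an instance of safety, with staying in
    \<open>St\<close> as the good step.\<close>
  interpret G: finite_chain K St "\<lambda>_ q q'. q \<in> St \<and> q' \<in> St"
    by unfold_locales (use finite_St K_closed in auto)
  have "G.safe_upto k n q = 1" if "q \<in> St" for k n q
    using that
  proof (induction k arbitrary: n q)
    case (Suc k)
    then have "G.safe_upto (Suc k) n q = (\<Sum>q'\<in>St. pmf (K n q) q')"
      by (subst G.safe_upto_Suc) (auto intro!: sum.cong)
    then show ?case using K_closed[OF Suc.prems] finite_St by (simp add: sum_pmf_eq_1)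
  qed simp
  then have safe: "G.safe n q = 1" if "q \<in> St" for n q
    using G.safe_upto_tendsto[of n q] that by (simp add: LIMSEQ_const_iff)
  let ?E = "{r. \<forall>i. r i \<in> St \<and> r (Suc i) \<in> St}"
  have E: "?E \<in> sets path_space" by (rule Collect_in_path_space) measurable
  have "measure (chain \<mu> K) ?E = (\<Sum>q\<in>St. pmf \<mu> q)"
    using safe[where n=0] by (subst measure_chain_eq_sum[OF \<mu> E]) (auto simp: G.safe_def intro!: sum.cong)
  also have "\<dots> = 1" using \<mu> finite_St by (simp add: sum_pmf_eq_1)
  finally have "AE r in chain \<mu> K. r \<in> ?E"
    using E by (subst prob_space.AE_in_set_eq_1[OF prob_space_chain]) auto
  then show ?thesis by eventually_elim auto
qed

end

text \<open>Finitely many values make the limit inferior finite, so \<open>real_of_ereal\<close>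
  loses nothing. They also let the weak bound pass to almost all terms, where in general only
  strictly smaller bounds would.\<close>

lemma le_real_of_liminf_iff:
  fixes x :: "nat \<Rightarrow> real"
  assumes V: "finite V" and x: "\<And>n. x n \<in> V"
  shows "\<eta> \<le> real_of_ereal (liminf (\<lambda>n. ereal (x n))) \<longleftrightarrow> (\<forall>\<^sub>F n in sequentially. \<eta> \<le> x n)"
proof -
  let ?L = "liminf (\<lambda>n. ereal (x n))"
  have "ereal (Min V) \<le> ?L" using V x by (intro Liminf_bounded) auto
  moreover have "?L \<le> ereal (Max V)"
  proof (rule ccontr)
    assume "\<not> ?thesis"
    then have "\<forall>\<^sub>F n in sequentially. ereal (Max V) < ereal (x n)"
      by (intro less_LiminfD) auto
    then obtain n where "Max V < x n" by (auto simp: eventually_sequentially)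
    with V x show False by (meson Max_ge not_le)
  qed
  ultimately have "?L = ereal (real_of_ereal ?L)"
    by (cases ?L) auto
  then have "\<eta> \<le> real_of_ereal ?L \<longleftrightarrow> ereal \<eta> \<le> ?L" by (metis ereal_less_eq(3))
  also have "\<dots> \<longleftrightarrow> (\<forall>\<^sub>F n in sequentially. \<eta> \<le> x n)"
  proof
    assume le: "ereal \<eta> \<le> ?L"
    show "\<forall>\<^sub>F n in sequentially. \<eta> \<le> x n"
    proof (cases "\<exists>v\<in>V. v < \<eta>")
      case True
      \<comment> \<open>The largest value below \<open>\<eta>\<close>: a term that exceeds it is
        already at least \<open>\<eta>\<close>.\<close>
      define v where "v = Max {v\<in>V. v < \<eta>}"
      have "v \<in> {v\<in>V. v < \<eta>}" unfolding v_def using V True by (intro Max_in) auto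
      then have "ereal v < ereal \<eta>" by simp
      also note le
      finally have "ereal v < ?L" .
      then have "\<forall>\<^sub>F n in sequentially. ereal v < ereal (x n)" by (rule less_LiminfD)
      then show ?thesis
      proof eventually_elim
        case (elim n)
        have "x n \<le> v" if "x n < \<eta>"
          unfolding v_def using V x[of n] that by (intro Max_ge) auto
        with elim show ?case by force
      qed
    next
      case False
      then have "\<eta> \<le> x n" for n using x[of n] by force
      then show ?thesis by (intro always_eventually) simp
    qed
  next
    assume "\<forall>\<^sub>F n in sequentially. \<eta> \<le> x n"
    then show "ereal \<eta> \<le> ?L" by (intro Liminf_bounded) (simp add: eventually_mono)
  qed
  finally show ?thesis .
qed

abbreviation step_weight :: "'a pwa \<Rightarrow> (nat \<Rightarrow> 'a) \<Rightarrow> (nat \<Rightarrow> nat) \<Rightarrow> nat \<Rightarrow> real" where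
  "step_weight A w r n \<equiv> real_of_rat (weight A (r n) (w n) (r (Suc n)))"

definition weights :: "'a set \<Rightarrow> 'a pwa \<Rightarrow> real set" where
  "weights \<Sigma> A = (\<lambda>(q, \<sigma>, q'). real_of_rat (weight A q \<sigma> q')) ` (states A \<times> \<Sigma> \<times> states A)"

definition prob_ge :: "'a pwa \<Rightarrow> (nat \<Rightarrow> 'a) \<Rightarrow> real \<Rightarrow> real" where
  "prob_ge A w \<eta> = measure (run_measure A w) {r. \<forall>\<^sub>F n in sequentially. \<eta> \<le> step_weight A w r n}"

lemma prob_space_run_measure: "prob_space (run_measure A w)"
  by (simp add: run_measure_eq_chain prob_space_chain)

lemma sets_run_measure [measurable_cong, simp]: "sets (run_measure A w) = sets path_space"
  by (simp add: run_measure_eq_chain)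

lemma space_run_measure [simp]: "space (run_measure A w) = UNIV"
  by (simp add: run_measure_eq_chain)

lemma pred_eventually_weight:
  "Measurable.pred path_space (\<lambda>r. \<forall>\<^sub>F n in sequentially. P (weight A (r n) (w n) (r (Suc n))))"
  by (rule pred_eventually_step)

lemma prob_ge_antimono:
  assumes "\<eta> \<le> \<theta>"
  shows "prob_ge A w \<theta> \<le> prob_ge A w \<eta>"
proof -
  interpret prob_space "run_measure A w" by (rule prob_space_run_measure)
  have "{r. \<forall>\<^sub>F n in sequentially. \<eta> \<le> step_weight A w r n} \<in> sets path_space"
    by (rule Collect_in_path_space[OF pred_eventually_weight])
  then show ?thesis unfolding prob_ge_def
    by (intro finite_measure_mono) (use assms in \<open>auto elim!: eventually_mono\<close>)
qed

lemma prob_ge_le_1: "prob_ge A w \<eta> \<le> 1"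
  by (simp add: prob_ge_def prob_space.prob_le_1[OF prob_space_run_measure])

locale pwa_word =
  fixes \<Sigma> :: "'a set" and A :: "'a pwa" and w :: "nat \<Rightarrow> 'a"
  assumes finite_\<Sigma>: "finite \<Sigma>" and wf: "wf_pwa \<Sigma> A" and word: "is_word \<Sigma> w"
begin

lemma finite_chain_trans: "finite_chain (\<lambda>i q. trans A q (w i)) (states A)"
  by unfold_locales (use wf word in \<open>auto simp: wf_pwa_def is_word_def\<close>)

lemma finite_weights: "finite (weights \<Sigma> A)"
  using wf finite_\<Sigma> by (auto simp: weights_def wf_pwa_def)

lemma step_weight_in_weights: "(\<And>n. r n \<in> states A) \<Longrightarrow> step_weight A w r n \<in> weights \<Sigma> A"
  using word by (force simp: weights_def is_word_def)

lemma AE_run_in_states: "AE r in run_measure A w. \<forall>n. r n \<in> states A"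
  unfolding run_measure_eq_chain
  by (rule finite_chain.AE_chain_in_states[OF finite_chain_trans]) (use wf in \<open>auto simp: wf_pwa_def\<close>)

lemma le_liminf_val_iff:
  assumes "\<And>n. r n \<in> states A"
  shows "\<eta> \<le> liminf_val A w r \<longleftrightarrow> (\<forall>\<^sub>F n in sequentially. \<eta> \<le> step_weight A w r n)"
  unfolding liminf_val_def
  by (rule le_real_of_liminf_iff[OF finite_weights]) (rule step_weight_in_weights[OF assms])

text \<open>The two events are compared on paths inside \<open>states A\<close>, where only finitely
  many weights occur; these paths have full measure.\<close>

lemma emeasure_liminf_val_ge:
  "emeasure (run_measure A w) {r \<in> space (run_measure A w). \<eta> \<le> liminf_val A w r} = ennreal (prob_ge A w \<eta>)"
proof -
  have "(\<lambda>r. (\<lambda>(xs :: nat list) r. ereal (real_of_rat (weight A (xs ! n) (w n) (xs ! Suc n)))) (map r [0..<Suc (Suc n)]) r)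
       \<in> path_space \<rightarrow>\<^sub>M borel" for n
    by (rule measurable_compose_countable[OF _ measurable_prefix]) simp
  then have [measurable]: "(\<lambda>r. ereal (step_weight A w r n)) \<in> path_space \<rightarrow>\<^sub>M borel" for n
    by (simp add: nth_append)
  have [measurable]: "liminf_val A w \<in> path_space \<rightarrow>\<^sub>M borel"
    unfolding liminf_val_def by measurable
  have "emeasure (run_measure A w) {r \<in> space (run_measure A w). \<eta> \<le> liminf_val A w r} =
      emeasure (run_measure A w) {r. \<forall>\<^sub>F n in sequentially. \<eta> \<le> step_weight A w r n}"
  proof (rule emeasure_eq_AE)
    show "AE r in run_measure A w. r \<in> {r \<in> space (run_measure A w). \<eta> \<le> liminf_val A w r} \<longleftrightarrow>
        r \<in> {r. \<forall>\<^sub>F n in sequentially. \<eta> \<le> step_weight A w r n}"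
      using AE_run_in_states by eventually_elim (simp add: le_liminf_val_iff)
  qed (auto intro!: Collect_in_path_space pred_eventually_weight, measurable)
  then show ?thesis
    by (simp add: prob_ge_def finite_measure.emeasure_eq_measure prob_space.finite_measure prob_space_run_measure)
qed

lemma pos_sem_eq: "pos_sem A w = Sup {\<eta>. prob_ge A w \<eta> > 0}"
  unfolding pos_sem_def emeasure_liminf_val_ge by simp

lemma as_sem_eq: "as_sem A w = Sup {\<eta>. prob_ge A w \<eta> = 1}"
  unfolding as_sem_def emeasure_liminf_val_ge by simp

lemma weights_nonempty: "weights \<Sigma> A \<noteq> {}"
proof -
  obtain q where "q \<in> set_pmf (init A)" using set_pmf_not_empty by fast
  then show ?thesis
    using wf word unfolding weights_def wf_pwa_def is_word_def by fastforce
qed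

lemma prob_ge_eq_1:
  assumes "\<eta> \<le> Min (weights \<Sigma> A)"
  shows "prob_ge A w \<eta> = 1"
proof -
  interpret prob_space "run_measure A w" by (rule prob_space_run_measure)
  have "AE r in run_measure A w. r \<in> {r. \<forall>\<^sub>F n in sequentially. \<eta> \<le> step_weight A w r n}"
    using AE_run_in_states
  proof eventually_elim
    case (elim r)
    then show ?case using step_weight_in_weights[of r] finite_weights assms
      by (auto intro!: always_eventually) (meson Min_le order_trans)
  qed
  then show ?thesis unfolding prob_ge_def
    by (subst (asm) AE_in_set_eq_1) (auto intro!: Collect_in_path_space pred_eventually_weight)
qed

text \<open>As a function of the threshold, \<open>prob_ge\<close> is a step function that can drop
  only just after a weight, so \<open>\<eta>\<close> may be rounded up to the next weight.\<close>

lemma prob_ge_posD: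
  assumes "prob_ge A w \<eta> > 0"
  shows "\<exists>v\<in>weights \<Sigma> A. \<eta> \<le> v \<and> prob_ge A w v = prob_ge A w \<eta>"
proof -
  interpret prob_space "run_measure A w" by (rule prob_space_run_measure)
  have ne: "{v\<in>weights \<Sigma> A. \<eta> \<le> v} \<noteq> {}"
  proof
    assume e: "{v\<in>weights \<Sigma> A. \<eta> \<le> v} = {}"
    have "AE r in run_measure A w. r \<notin> {r. \<forall>\<^sub>F n in sequentially. \<eta> \<le> step_weight A w r n}"
      using AE_run_in_states
    proof eventually_elim
      case (elim r)
      then show ?case using step_weight_in_weights[of r] e by (auto simp: eventually_sequentially)
    qed
    then have "prob_ge A w \<eta> = 0" unfolding prob_ge_def
      by (subst prob_eq_0) (auto intro!: Collect_in_path_space pred_eventually_weight)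
    with assms show False by simp
  qed
  define v where "v = Min {v\<in>weights \<Sigma> A. \<eta> \<le> v}"
  have v: "v \<in> weights \<Sigma> A" "\<eta> \<le> v"
    using Min_in[OF _ ne] finite_weights by (auto simp: v_def)
  have "prob_ge A w v = prob_ge A w \<eta>" unfolding prob_ge_def
  proof (rule measure_eq_AE)
    show "AE r in run_measure A w. r \<in> {r. \<forall>\<^sub>F n in sequentially. v \<le> step_weight A w r n} \<longleftrightarrow>
        r \<in> {r. \<forall>\<^sub>F n in sequentially. \<eta> \<le> step_weight A w r n}"
      using AE_run_in_states
    proof eventually_elim
      case (elim r)
      then have "v \<le> step_weight A w r n \<longleftrightarrow> \<eta> \<le> step_weight A w r n" for n
        using step_weight_in_weights[of r n] v(2) finite_weights by (auto simp: v_def intro!: Min_le)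
      then show ?case by simp
    qed
  qed (auto intro!: Collect_in_path_space pred_eventually_weight)
  with v show ?thesis by auto
qed

lemma prob_ge_pos_le_Max: "prob_ge A w \<eta> > 0 \<Longrightarrow> \<eta> \<le> Max (weights \<Sigma> A)"
  using prob_ge_posD finite_weights Max_ge by (meson order_trans)

lemma bdd_above_prob_ge: "bdd_above {\<eta>. prob_ge A w \<eta> = 1}"
  using prob_ge_pos_le_Max by (auto intro!: bdd_aboveI[of _ "Max (weights \<Sigma> A)"])

lemma prob_ge_1_nonempty: "{\<eta>. prob_ge A w \<eta> = 1} \<noteq> {}"
  using prob_ge_eq_1 by blast

end

text \<open>As a function of \<open>\<eta>\<close>, \<open>prob_ge\<close> is 1 up to
  \<open>u\<close>, then \<open>P\<close> up to \<open>M\<close>, and 0 beyond. This turns a test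
  for finitely many bad steps into a quantitative language.\<close>

lemma two_valued_sem:
  assumes A: "pwa_word \<Sigma> A w" and uM: "u \<le> M"
    and weight: "\<And>q \<sigma> q'. weight A q \<sigma> q' = (if bad q \<sigma> q' then u else M)"
  defines "P \<equiv> measure (run_measure A w) {r. \<forall>\<^sub>F n in sequentially. \<not> bad (r n) (w n) (r (Suc n))}"
  shows "as_sem A w = (if P = 1 then real_of_rat M else real_of_rat u)"
    and "pos_sem A w = (if P > 0 then real_of_rat M else real_of_rat u)"
proof -
  interpret pwa_word \<Sigma> A w by fact
  interpret prob_space "run_measure A w" by (rule prob_space_run_measure)
  let ?u = "real_of_rat u" and ?M = "real_of_rat M"
  have uM': "?u \<le> ?M" using uM by (simp add: of_rat_less_eq)
  have low: "prob_ge A w \<eta> = 1" if "\<eta> \<le> ?u" for \<eta>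
  proof -
    have "{r. \<forall>\<^sub>F n in sequentially. \<eta> \<le> step_weight A w r n} = UNIV"
      using that uM' by (auto simp: weight intro!: always_eventually)
    then show ?thesis using prob_space by (simp add: prob_ge_def)
  qed
  have mid: "prob_ge A w \<eta> = P" if "?u < \<eta>" "\<eta> \<le> ?M" for \<eta>
  proof -
    have "\<eta> \<le> step_weight A w r n \<longleftrightarrow> \<not> bad (r n) (w n) (r (Suc n))" for r n
      using that by (auto simp: weight)
    then show ?thesis by (simp add: prob_ge_def P_def)
  qed
  have high: "prob_ge A w \<eta> = 0" if "?M < \<eta>" for \<eta>
  proof -
    have "{r. \<forall>\<^sub>F n in sequentially. \<eta> \<le> step_weight A w r n} = {}"
      using that uM' by (auto simp: weight eventually_sequentially)
    then show ?thesis by (simp add: prob_ge_def)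
  qed
  have "prob_ge A w \<eta> = (if \<eta> \<le> ?u then 1 else if \<eta> \<le> ?M then P else 0)" for \<eta>
    using low mid high by (simp add: not_le)
  then have "{\<eta>. prob_ge A w \<eta> = 1} = (if P = 1 then {..?M} else {..?u})"
    and "{\<eta>. prob_ge A w \<eta> > 0} = (if P > 0 then {..?M} else {..?u})"
    using uM' by (auto split: if_splits)
  then show "as_sem A w = (if P = 1 then ?M else ?u)" "pos_sem A w = (if P > 0 then ?M else ?u)"
    unfolding as_sem_eq pos_sem_eq by simp_all
qed

section \<open>Products and two-valued automata\<close>

definition deterministic :: "'a pwa \<Rightarrow> bool" where
  "deterministic A \<longleftrightarrow> (\<exists>q. init A = return_pmf q) \<and> (\<forall>q \<sigma>. \<exists>q'. trans A q \<sigma> = return_pmf q')"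

lemma measure_chain_deterministic:
  assumes \<rho>: "\<rho> 0 = q0" "\<And>n. \<rho> (Suc n) = t n (\<rho> n)" and P: "Measurable.pred path_space P"
  shows "measure (chain (return_pmf q0) (\<lambda>n q. return_pmf (t n q))) {r. P r} = of_bool (P \<rho>)"
proof -
  let ?M = "chain (return_pmf q0) (\<lambda>n q. return_pmf (t n q))"
  interpret prob_space ?M by (rule prob_space_chain)
  have "AE r in ?M. \<forall>k. \<forall>i\<le>k. r i = \<rho> i"
  proof (rule AE_all_countable[THEN iffD2], rule allI)
    fix k
    have "{r. \<forall>i\<le>k. r i = \<rho> i} \<in> sets path_space"
      by (rule Collect_in_path_space) measurable
    moreover have "emeasure ?M {r. \<forall>i\<le>k. r i = \<rho> i} = 1"
      unfolding emeasure_chain_cylinder by (simp add: \<rho>)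
    ultimately have "AE r in ?M. r \<in> {r. \<forall>i\<le>k. r i = \<rho> i}"
      by (intro AE_in_set_eq_1[THEN iffD2]) (simp_all add: measure_def)
    then show "AE r in ?M. \<forall>i\<le>k. r i = \<rho> i" by simp
  qed
  then have "AE r in ?M. r = \<rho>" by eventually_elim auto
  then have "measure ?M {r. P r} = measure ?M {r. P \<rho>}"
    using Collect_in_path_space[OF P] by (intro measure_eq_AE) auto
  then show ?thesis using prob_space by (cases "P \<rho>") auto
qed

lemma deterministic_pos_sem:
  assumes "pwa_word \<Sigma> A w" and det: "deterministic A"
  shows "pos_sem A w = as_sem A w"
proof -
  interpret pwa_word \<Sigma> A w by fact
  interpret prob_space "run_measure A w" by (rule prob_space_run_measure)
  obtain q0 where q0: "init A = return_pmf q0" using det by (auto simp: deterministic_def)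
  obtain t where t: "\<And>q \<sigma>. trans A q \<sigma> = return_pmf (t q \<sigma>)"
    using det unfolding deterministic_def by metis
  have "prob_ge A w \<eta> \<in> {0, 1}" for \<eta>
    unfolding prob_ge_def run_measure_eq_chain q0 t
    by (subst measure_chain_deterministic[where \<rho>="rec_nat q0 (\<lambda>n q. t q (w n))"])
       (auto intro!: pred_eventually_weight)
  then have "prob_ge A w \<eta> > 0 \<longleftrightarrow> prob_ge A w \<eta> = 1" for \<eta>
    by (metis insert_iff less_irrefl singletonD zero_less_one)
  then show ?thesis unfolding pos_sem_eq as_sem_eq by simp
qed

definition product_pwa :: "'a pwa \<Rightarrow> 'a pwa \<Rightarrow> 'a pwa" where
  "product_pwa A B = \<lparr>
     states = prod_encode ` (states A \<times> states B),
     init = map_pmf prod_encode (pair_pmf (init A) (init B)),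
     trans = (\<lambda>x \<sigma>. map_pmf prod_encode (pair_pmf
       (trans A (fst (prod_decode x)) \<sigma>) (trans B (snd (prod_decode x)) \<sigma>))),
     weight = (\<lambda>x \<sigma> y. min (weight A (fst (prod_decode x)) \<sigma> (fst (prod_decode y)))
       (weight B (snd (prod_decode x)) \<sigma> (snd (prod_decode y))))\<rparr>"

lemma wf_product_pwa:
  assumes A: "wf_pwa \<Sigma> A" and B: "wf_pwa \<Sigma> B"
  shows "wf_pwa \<Sigma> (product_pwa A B)"
  unfolding wf_pwa_def
proof (intro conjI ballI)
  show "finite (states (product_pwa A B))" "set_pmf (init (product_pwa A B)) \<subseteq> states (product_pwa A B)"
    using A B by (simp_all add: wf_pwa_def product_pwa_def Sigma_mono image_mono)
  fix x \<sigma> assume "x \<in> states (product_pwa A B)" and \<sigma>: "\<sigma> \<in> \<Sigma>"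
  then obtain p q where "x = prod_encode (p, q)" "p \<in> states A" "q \<in> states B"
    by (auto simp: product_pwa_def)
  with A B \<sigma> show "set_pmf (trans (product_pwa A B) x \<sigma>) \<subseteq> states (product_pwa A B)"
    by (simp add: wf_pwa_def product_pwa_def Sigma_mono image_mono)
qed

lemma deterministic_product_pwa:
  assumes "deterministic A" "deterministic B"
  shows "deterministic (product_pwa A B)"
proof -
  from assms obtain p f q g where "init A = return_pmf p" "\<And>q \<sigma>. trans A q \<sigma> = return_pmf (f q \<sigma>)"
    and "init B = return_pmf q" "\<And>q \<sigma>. trans B q \<sigma> = return_pmf (g q \<sigma>)"
    unfolding deterministic_def by metis
  then show ?thesis by (auto simp: deterministic_def product_pwa_def pair_return_pmf1)
qed

lemma measurable_comp_path:
  "(\<lambda>(r :: nat \<Rightarrow> 's::countable) i. h (r i)) \<in> path_space \<rightarrow>\<^sub>M path_space"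
  by (rule measurable_PiM_single') (auto simp: PiE_def extensional_def)

lemma measure_run_image:
  fixes K :: "nat \<Rightarrow> 's::countable \<Rightarrow> 's pmf"
  assumes "map_pmf h \<mu> = init A" and "\<And>i q. map_pmf h (K i q) = trans A (h q) (w i)"
    and P: "Measurable.pred path_space P"
  shows "measure (run_measure A w) {r. P r} = measure (chain \<mu> K) {r. P (\<lambda>i. h (r i))}"
proof -
  have "run_measure A w = distr (chain \<mu> K) path_space (\<lambda>r i. h (r i))"
    unfolding run_measure_eq_chain using assms(1,2) by (subst distr_chain) auto
  then show ?thesis
    using measurable_comp_path[of h] Collect_in_path_space[OF P]
    by (simp add: measure_distr vimage_def)
qed

text \<open>An intersection of two events has probability 1 iff both events have, so it suffices to
  know the marginals of the product chain, which are the chains of \<open>A\<close> and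
  \<open>B\<close>.\<close>

lemma prob_ge_product_pwa:
  "prob_ge (product_pwa A B) w \<eta> = 1 \<longleftrightarrow> prob_ge A w \<eta> = 1 \<and> prob_ge B w \<eta> = 1"
proof -
  let ?R = "run_measure (product_pwa A B) w"
  interpret prob_space ?R by (rule prob_space_run_measure)
  let ?f = "\<lambda>x. fst (prod_decode x)" and ?g = "\<lambda>x. snd (prod_decode x)"
  let ?P = "\<lambda>C r. \<forall>\<^sub>F n in sequentially. \<eta> \<le> step_weight C w r n"
  let ?X = "{r. ?P A (\<lambda>i. ?f (r i))}" and ?Y = "{r. ?P B (\<lambda>i. ?g (r i))}"
  have meas: "?X \<in> sets path_space" "?Y \<in> sets path_space"
    by (rule Collect_in_path_space, rule pred_eventually_step)+
  have A: "prob_ge A w \<eta> = measure ?R ?X"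
    unfolding prob_ge_def run_measure_eq_chain[of "product_pwa A B"]
    by (rule measure_run_image[OF _ _ pred_eventually_weight])
       (simp_all add: product_pwa_def map_pmf_comp map_fst_pair_pmf)
  have B: "prob_ge B w \<eta> = measure ?R ?Y"
    unfolding prob_ge_def run_measure_eq_chain[of "product_pwa A B"]
    by (rule measure_run_image[OF _ _ pred_eventually_weight])
       (simp_all add: product_pwa_def map_pmf_comp map_snd_pair_pmf)
  have "\<eta> \<le> real_of_rat (min a b) \<longleftrightarrow> \<eta> \<le> real_of_rat a \<and> \<eta> \<le> real_of_rat b" for a b
    by (auto simp: min_def of_rat_less_eq not_le)
       (meson of_rat_less_eq less_imp_le order_trans)+
  then have "prob_ge (product_pwa A B) w \<eta> = measure ?R (?X \<inter> ?Y)"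
    unfolding prob_ge_def
    by (auto simp: product_pwa_def eventually_conj_iff intro!: arg_cong[where f="measure _"])
  also have "\<dots> = 1 \<longleftrightarrow> (AE r in ?R. r \<in> ?X \<inter> ?Y)"
    using meas by (subst AE_in_set_eq_1) auto
  also have "\<dots> \<longleftrightarrow> (AE r in ?R. r \<in> ?X) \<and> (AE r in ?R. r \<in> ?Y)"
    by auto
  also have "\<dots> \<longleftrightarrow> measure ?R ?X = 1 \<and> measure ?R ?Y = 1"
    using meas by (subst (1 2) AE_in_set_eq_1) auto
  finally show ?thesis by (simp only: A B)
qed

text \<open>The sets whose suprema are taken are downward closed, hence nested, and the smaller one
  is their intersection.\<close>

lemma as_sem_product_pwa:
  assumes "pwa_word \<Sigma> A w" "pwa_word \<Sigma> B w"
  shows "as_sem (product_pwa A B) w = min (as_sem A w) (as_sem B w)"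
proof -
  interpret A: pwa_word \<Sigma> A w by fact
  interpret B: pwa_word \<Sigma> B w by fact
  interpret AB: pwa_word \<Sigma> "product_pwa A B" w
    by unfold_locales (simp_all add: A.finite_\<Sigma> A.word A.wf B.wf wf_product_pwa)
  let ?X = "\<lambda>C. {\<eta>. prob_ge C w \<eta> = 1}"
  have down: "\<theta> \<in> ?X C" if "\<eta> \<in> ?X C" "\<theta> \<le> \<eta>" for C \<eta> \<theta>
    using that prob_ge_antimono[OF that(2), of C w] prob_ge_le_1[of C w \<theta>] by auto
  have X: "?X (product_pwa A B) = ?X A \<inter> ?X B" by (auto simp: prob_ge_product_pwa)
  have "?X A \<subseteq> ?X B \<or> ?X B \<subseteq> ?X A"
    using down by (meson linorder_linear subsetI)
  then show ?thesis
  proof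
    assume le: "?X A \<subseteq> ?X B"
    then have "Sup (?X A) \<le> Sup (?X B)"
      by (intro cSup_subset_mono A.prob_ge_1_nonempty B.bdd_above_prob_ge)
    with le show ?thesis unfolding A.as_sem_eq B.as_sem_eq AB.as_sem_eq X
      by (simp add: Int_absorb2 min_def)
  next
    assume le: "?X B \<subseteq> ?X A"
    then have "Sup (?X B) \<le> Sup (?X A)"
      by (intro cSup_subset_mono B.prob_ge_1_nonempty A.bdd_above_prob_ge)
    with le show ?thesis unfolding A.as_sem_eq B.as_sem_eq AB.as_sem_eq X
      by (simp add: Int_absorb1 min_def)
  qed
qed

text \<open>The flag carries determinism through the closure under minima, so that one closure lemma
  serves both reductions.\<close>

definition as_recognizable :: "bool \<Rightarrow> 'a set \<Rightarrow> ((nat \<Rightarrow> 'a) \<Rightarrow> real) \<Rightarrow> bool" where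
  "as_recognizable d \<Sigma> L \<longleftrightarrow> (\<exists>A. wf_pwa \<Sigma> A \<and> (d \<longrightarrow> deterministic A) \<and>
     (\<forall>w. is_word \<Sigma> w \<longrightarrow> as_sem A w = L w))"

lemma as_recognizable_min:
  assumes "finite \<Sigma>" "as_recognizable d \<Sigma> L" "as_recognizable d \<Sigma> L'"
  shows "as_recognizable d \<Sigma> (\<lambda>w. min (L w) (L' w))"
proof -
  obtain A B where A: "wf_pwa \<Sigma> A" "d \<longrightarrow> deterministic A" "\<And>w. is_word \<Sigma> w \<Longrightarrow> as_sem A w = L w"
    and B: "wf_pwa \<Sigma> B" "d \<longrightarrow> deterministic B" "\<And>w. is_word \<Sigma> w \<Longrightarrow> as_sem B w = L' w"
    using assms(2,3) unfolding as_recognizable_def by blast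
  have "as_sem (product_pwa A B) w = min (L w) (L' w)" if "is_word \<Sigma> w" for w
  proof -
    have "pwa_word \<Sigma> A w" "pwa_word \<Sigma> B w"
      using that A(1) B(1) assms(1) by (simp_all add: pwa_word_def)
    from as_sem_product_pwa[OF this] show ?thesis
      by (simp only: A(3)[OF that] B(3)[OF that])
  qed
  then show ?thesis unfolding as_recognizable_def
    using A(1,2) B(1,2)
    by (intro exI[of _ "product_pwa A B"]) (auto simp: wf_product_pwa deterministic_product_pwa)
qed

lemma as_recognizable_Min:
  assumes "finite \<Sigma>" "finite W" "W \<noteq> {}" "\<And>u. u \<in> W \<Longrightarrow> as_recognizable d \<Sigma> (f u)"
  shows "as_recognizable d \<Sigma> (\<lambda>w. Min ((\<lambda>u. f u w) ` W))"
  using assms(2-)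
proof (induction W rule: finite_ne_induct)
  case (insert u W)
  then have "as_recognizable d \<Sigma> (\<lambda>w. min (f u w) (Min ((\<lambda>u. f u w) ` W)))"
    by (intro as_recognizable_min[OF assms(1)]) auto
  then show ?case using insert by simp
qed simp

text \<open>Lets the constructions use any countable type of states: \<open>to_nat\<close> moves
  them to numbers, and the law of the chain is transported along this encoding.\<close>

lemma as_recognizable_two_valued:
  fixes St :: "'s::countable set"
  assumes \<Sigma>: "finite \<Sigma>" and fin: "finite St" and i: "set_pmf i \<subseteq> St"
    and t: "\<And>q \<sigma>. q \<in> St \<Longrightarrow> \<sigma> \<in> \<Sigma> \<Longrightarrow> set_pmf (t q \<sigma>) \<subseteq> St"
    and det: "d \<Longrightarrow> (\<exists>q. i = return_pmf q) \<and> (\<forall>q \<sigma>. \<exists>q'. t q \<sigma> = return_pmf q')"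
    and uM: "u \<le> M"
    and acc: "\<And>w. is_word \<Sigma> w \<Longrightarrow> measure (chain i (\<lambda>n q. t q (w n)))
       {r. \<forall>\<^sub>F n in sequentially. \<not> bad (r n) (w n) (r (Suc n))} = 1 \<longleftrightarrow> acc w"
  shows "as_recognizable d \<Sigma> (\<lambda>w. if acc w then real_of_rat M else real_of_rat u)"
proof -
  define A where "A = \<lparr>states = to_nat ` St, init = map_pmf to_nat i,
    trans = (\<lambda>x \<sigma>. map_pmf to_nat (t (from_nat x) \<sigma>)),
    weight = (\<lambda>x \<sigma> y. if bad (from_nat x) \<sigma> (from_nat y) then u else M)\<rparr>"
  have wf: "wf_pwa \<Sigma> A"
    unfolding wf_pwa_def
  proof (intro conjI ballI)
    show "finite (states A)" "set_pmf (init A) \<subseteq> states A"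
      using fin i by (simp_all add: A_def image_mono)
    fix x \<sigma> assume "x \<in> states A" "\<sigma> \<in> \<Sigma>"
    then obtain q where "x = to_nat q" "set_pmf (t q \<sigma>) \<subseteq> St"
      using t by (auto simp: A_def)
    then show "set_pmf (trans A x \<sigma>) \<subseteq> states A"
      by (simp add: A_def image_mono)
  qed
  have sem: "as_sem A w = (if acc w then real_of_rat M else real_of_rat u)" if w: "is_word \<Sigma> w" for w
  proof -
    have "measure (run_measure A w) {r. \<forall>\<^sub>F n in sequentially.
            \<not> bad (from_nat (r n)) (w n) (from_nat (r (Suc n)))} =
       measure (chain i (\<lambda>n q. t q (w n))) {r. \<forall>\<^sub>F n in sequentially.
            \<not> bad (from_nat (to_nat (r n))) (w n) (from_nat (to_nat (r (Suc n))))}"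
      by (rule measure_run_image) (auto simp: A_def intro!: pred_eventually_step)
    then show ?thesis using acc[OF w]
      by (subst two_valued_sem(1)[of \<Sigma> A w u M "\<lambda>x \<sigma> y. bad (from_nat x) \<sigma> (from_nat y)"])
         (use w wf uM \<Sigma> in \<open>auto simp: pwa_word_def A_def\<close>)
  qed
  have "d \<longrightarrow> deterministic A"
    using det unfolding deterministic_def A_def by simp (metis map_return_pmf)
  with wf sem show ?thesis unfolding as_recognizable_def by blast
qed

text \<open>A value \<open>L\<close> in \<open>W\<close> is the minimum of its threshold functions, since the
  least \<open>u \<in> W\<close> that \<open>L\<close> does not exceed is \<open>L\<close> itself.\<close>

lemma Min_thresholds:
  fixes L :: "'b::linorder"
  assumes W: "finite W" "W \<noteq> {}" and L: "Min W \<le> L" "L \<le> Max W"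
    and pos: "\<And>u. u \<in> W \<Longrightarrow> c u \<Longrightarrow> \<exists>v\<in>W. u < v \<and> v \<le> L"
    and neg: "\<And>u. u \<in> W \<Longrightarrow> \<not> c u \<Longrightarrow> L \<le> u"
  shows "L = Min ((\<lambda>u. if c u then Max W else u) ` W)"
proof (rule antisym)
  show "L \<le> Min ((\<lambda>u. if c u then Max W else u) ` W)"
    using W L(2) neg by (intro Min.boundedI) auto
  \<comment> \<open>The greatest element of \<open>W\<close> that is at most \<open>L\<close>. If
    \<open>c u\<close> held, \<open>pos\<close> would give a greater one; so \<open>u\<close> itself
    enters the minimum.\<close>
  define u where "u = Max {v\<in>W. v \<le> L}"
  have "{v\<in>W. v \<le> L} \<noteq> {}" using W L(1) Min_in by blast
  then have u: "u \<in> W" "u \<le> L" using Max_in[of "{v\<in>W. v \<le> L}"] W(1) by (auto simp: u_def)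
  have "\<not> c u"
    using pos[OF u(1)] W(1) by (auto simp: u_def dest: Max_ge[rotated] simp flip: not_le)
  then have "Min ((\<lambda>u. if c u then Max W else u) ` W) \<le> u"
    using W u(1) by (intro Min_le) (auto intro: rev_image_eqI)
  with u(2) show "Min ((\<lambda>u. if c u then Max W else u) ` W) \<le> L" by simp
qed

section \<open>The restart automaton\<close>

lemma (in finite_chain) safe_upto_Suc_integral:
  assumes q: "q \<in> St"
  shows "safe_upto (Suc k) n q = (\<integral>q'. (if good n q q' then safe_upto k (Suc n) q' else 0) \<partial>K n q)"
  unfolding safe_upto_Suc[OF q] using K_closed[OF q]
  by (subst integral_measure_pmf_real[OF finite_St]) (auto intro!: sum.cong)

definition post :: "'a pwa \<Rightarrow> nat set \<Rightarrow> 'a \<Rightarrow> nat set" where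
  "post A S \<sigma> = (\<Union>q\<in>S. set_pmf (trans A q \<sigma>))"

lemma post_subset:
  assumes "wf_pwa \<Sigma> A" "\<sigma> \<in> \<Sigma>" "S \<subseteq> states A"
  shows "post A S \<sigma> \<subseteq> states A"
  using assms unfolding post_def wf_pwa_def by (meson UN_least subsetD)

text \<open>A state \<open>(set_encode S, q, b)\<close> of the restart automaton records the set \<open>S\<close> of states of \<open>A\<close>
  reachable on the input, the current state \<open>q\<close> of a simulated run, and whether the simulation has
  just been restarted in a random element of \<open>S\<close>, which happens whenever a weight is at most \<open>u\<close>.\<close>

definition restart_trans :: "'a pwa \<Rightarrow> rat \<Rightarrow> nat \<times> nat \<times> bool \<Rightarrow> 'a \<Rightarrow> (nat \<times> nat \<times> bool) pmf" where
  "restart_trans A u x \<sigma> =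
     (let S = post A (set_decode (fst x)) \<sigma>; q = fst (snd x) in
      bind_pmf (trans A q \<sigma>) (\<lambda>q'.
        if u < weight A q \<sigma> q' then return_pmf (set_encode S, q', False)
        else map_pmf (\<lambda>p. (set_encode S, p, True)) (pmf_of_set S)))"

definition restart_init :: "'a pwa \<Rightarrow> (nat \<times> nat \<times> bool) pmf" where
  "restart_init A = map_pmf (\<lambda>q. (set_encode (set_pmf (init A)), q, False)) (init A)"

definition restart_states :: "'a pwa \<Rightarrow> (nat \<times> nat \<times> bool) set" where
  "restart_states A = {(s, q, b). set_decode s \<subseteq> states A \<and> q \<in> set_decode s}"

lemma finite_restart_states:
  assumes "finite (states A)"
  shows "finite (restart_states A)"
proof (rule finite_subset)
  show "restart_states A \<subseteq> set_encode ` Pow (states A) \<times> states A \<times> UNIV"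
    by (auto simp: restart_states_def) (metis Pow_iff image_eqI set_decode_inverse)
  show "finite (set_encode ` Pow (states A) \<times> states A \<times> (UNIV :: bool set))"
    using assms by simp
qed

lemma restart_trans_closed:
  assumes A: "wf_pwa \<Sigma> A" "\<sigma> \<in> \<Sigma>" and x: "x \<in> restart_states A"
  shows "set_pmf (restart_trans A u x \<sigma>) \<subseteq> restart_states A"
proof -
  obtain s q b where [simp]: "x = (s, q, b)" by (cases x)
  let ?S = "post A (set_decode s) \<sigma>"
  have S: "?S \<subseteq> states A" using post_subset[OF A] x by (simp add: restart_states_def)
  then have fin: "finite ?S" using A by (auto simp: wf_pwa_def intro: finite_subset)
  have *: "set_pmf (trans A q \<sigma>) \<subseteq> ?S" using x by (auto simp: restart_states_def post_def)
  have "?S \<noteq> {}" using * set_pmf_not_empty[of "trans A q \<sigma>"] by auto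
  then have "set_pmf (pmf_of_set ?S) = ?S" using fin by (rule set_pmf_of_set)
  with S * fin show ?thesis
    by (auto simp: restart_trans_def restart_states_def Let_def split: if_splits) blast+
qed

context pwa_word
begin

sublocale A: finite_chain "\<lambda>i q. trans A q (w i)" "states A" "\<lambda>n q q'. u < weight A q (w n) q'" for u
  by (rule finite_chain_trans)

abbreviation reachable :: "nat \<Rightarrow> nat set" where
  "reachable \<equiv> A.reach (set_pmf (init A))"

lemma init_subset: "set_pmf (init A) \<subseteq> states A"
  using wf by (simp add: wf_pwa_def)

lemma reachable_subset: "reachable n \<subseteq> states A"
  by (rule A.reach_subset[OF init_subset])

lemma finite_states: "finite (states A)"
  using wf by (simp add: wf_pwa_def)

lemma finite_reachable: "finite (reachable n)"
  using reachable_subset finite_states by (rule finite_subset)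

lemma reachable_Suc: "reachable (Suc n) = post A (reachable n) (w n)"
  by (simp add: post_def)

lemma reachable_nonempty: "reachable n \<noteq> {}"
  by (rule A.reach_nonempty) (rule set_pmf_not_empty)

lemma pos_iff_reachable_safe:
  "measure (run_measure A w) {r. \<forall>\<^sub>F n in sequentially. u < weight A (r n) (w n) (r (Suc n))} > 0 \<longleftrightarrow>
    (\<exists>n. \<exists>q\<in>reachable n. A.safe u n q > 0)"
  unfolding run_measure_eq_chain by (rule A.ev_safe_pos_iff[OF init_subset])

end

locale restart = pwa_word +
  fixes u :: rat
begin

abbreviation RK :: "nat \<Rightarrow> nat \<times> nat \<times> bool \<Rightarrow> (nat \<times> nat \<times> bool) pmf" where
  "RK n x \<equiv> restart_trans A u x (w n)"

text \<open>The set of reachable states is determined by the input, so a configuration reachable at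
  time \<open>n\<close> is given by \<open>q\<close> and the flag alone.\<close>

definition conf :: "nat \<Rightarrow> nat \<Rightarrow> bool \<Rightarrow> nat \<times> nat \<times> bool" where
  "conf n q b = (set_encode (reachable n), q, b)"

sublocale R: finite_chain RK "restart_states A" "\<lambda>_ _ y. \<not> snd (snd y)"
  using finite_restart_states[OF finite_states] restart_trans_closed[OF wf] word
  by unfold_locales (auto simp: is_word_def)

lemma conf_in_restart_states: "q \<in> reachable n \<Longrightarrow> conf n q b \<in> restart_states A"
  using reachable_subset[of n] finite_reachable[of n]
  by (auto simp: conf_def restart_states_def)

lemma RK_conf:
  "RK n (conf n q b) = bind_pmf (trans A q (w n)) (\<lambda>q'.
        if u < weight A q (w n) q' then return_pmf (conf (Suc n) q' False)
        else map_pmf (\<lambda>p. conf (Suc n) p True) (pmf_of_set (reachable (Suc n))))"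
  using finite_reachable[of n]
  by (simp add: conf_def restart_trans_def reachable_Suc Let_def cong: if_cong del: A.reach.simps)

lemma integral_RK:
  fixes f :: "_ \<Rightarrow> real"
  assumes q: "q \<in> reachable n"
  shows "(\<integral>y. f y \<partial>RK n (conf n q b)) = (\<Sum>q'\<in>states A. pmf (trans A q (w n)) q' *
    (if u < weight A q (w n) q' then f (conf (Suc n) q' False)
     else (\<Sum>p\<in>reachable (Suc n). f (conf (Suc n) p True)) / card (reachable (Suc n))))"
proof -
  have "(\<integral>y. f y \<partial>RK n (conf n q b)) = (\<Sum>q'\<in>states A. pmf (trans A q (w n)) q' *\<^sub>R
     (\<integral>y. f y \<partial>(if u < weight A q (w n) q' then return_pmf (conf (Suc n) q' False)
        else map_pmf (\<lambda>p. conf (Suc n) p True) (pmf_of_set (reachable (Suc n))))))"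
    unfolding RK_conf
    using q reachable_subset[of n] A.K_closed[of q n] finite_reachable[of "Suc n"] reachable_nonempty[of "Suc n"]
    by (intro pmf_expectation_bind finite_states) (auto simp del: A.reach.simps)
  also have "\<dots> = (\<Sum>q'\<in>states A. pmf (trans A q (w n)) q' *
    (if u < weight A q (w n) q' then f (conf (Suc n) q' False)
     else (\<Sum>p\<in>reachable (Suc n). f (conf (Suc n) p True)) / card (reachable (Suc n))))" (is "_ = sum ?g _")
  proof (rule sum.cong[OF refl])
    fix q'
    show "pmf (trans A q (w n)) q' *\<^sub>R
     (\<integral>y. f y \<partial>(if u < weight A q (w n) q' then return_pmf (conf (Suc n) q' False)
        else map_pmf (\<lambda>p. conf (Suc n) p True) (pmf_of_set (reachable (Suc n))))) = ?g q'"
      using finite_reachable[of "Suc n"] reachable_nonempty[of "Suc n"]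
      by (cases "u < weight A q (w n) q'") (simp_all add: integral_pmf_of_set del: A.reach.simps)
  qed
  finally show ?thesis .
qed

text \<open>Until its first restart the automaton moves exactly as \<open>A\<close> does, so the
  absence of restarts from here on is safety of the simulated run.\<close>

lemma R_safe: "q \<in> reachable n \<Longrightarrow> R.safe n (conf n q b) = A.safe u n q"
proof -
  have "R.safe_upto k n (conf n q b) = A.safe_upto u k n q" if "q \<in> reachable n" for k
    using that
  proof (induction k arbitrary: n q b)
    case (Suc k)
    have q: "q \<in> states A" using Suc.prems reachable_subset by auto
    show ?case
      unfolding R.safe_upto_Suc_integral[OF conf_in_restart_states[OF Suc.prems]] integral_RK[OF Suc.prems]
        A.safe_upto_Suc[OF q]
    proof (rule sum.cong[OF refl])
      fix q'
      show "pmf (trans A q (w n)) q' * (if u < weight A q (w n) q'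
          then if \<not> snd (snd (conf (Suc n) q' False)) then R.safe_upto k (Suc n) (conf (Suc n) q' False) else 0
          else (\<Sum>p\<in>reachable (Suc n). if \<not> snd (snd (conf (Suc n) p True))
             then R.safe_upto k (Suc n) (conf (Suc n) p True) else 0) / card (reachable (Suc n))) =
        pmf (trans A q (w n)) q' * (if u < weight A q (w n) q' then A.safe_upto u k (Suc n) q' else 0)"
        using Suc.IH[of q' "Suc n" False] Suc.prems
        by (cases "q' \<in> set_pmf (trans A q (w n))") (auto simp: conf_def set_pmf_iff)
    qed
  qed simp
  then show "R.safe n (conf n q b) = A.safe u n q" if "q \<in> reachable n"
    using R.safe_upto_tendsto[of n "conf n q b"] A.safe_upto_tendsto[of u n q] that
    by (simp add: LIMSEQ_unique)
qed

definition restarts_ge :: "nat \<Rightarrow> nat \<Rightarrow> nat \<Rightarrow> nat \<times> nat \<times> bool \<Rightarrow> real" where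
  "restarts_ge j N n x = measure (chain_from RK n x) {r. j \<le> (\<Sum>i<N. of_bool (snd (snd (r (Suc i)))))}"

lemma pred_restarts [measurable]:
  "Measurable.pred path_space (\<lambda>r. j \<le> (\<Sum>i<N. of_bool (snd (snd ((r :: nat \<Rightarrow> nat \<times> nat \<times> bool) (Suc i)))) :: nat))"
proof -
  have "Measurable.pred path_space (\<lambda>r :: nat \<Rightarrow> nat \<times> nat \<times> bool.
      (\<lambda>xs r. j \<le> (\<Sum>i<N. of_bool (snd (snd (xs ! (Suc i)))) :: nat)) (map r [0..<Suc N]) r)"
    by (rule measurable_compose_countable[OF _ measurable_prefix]) simp
  then show ?thesis by (simp del: upt_Suc)
qed

lemma restarts_ge_0 [simp]: "restarts_ge 0 N n x = 1"
  using prob_space.prob_space[OF prob_space_chain_from, of RK n x] by (simp add: restarts_ge_def)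

lemma restarts_ge_Suc_0 [simp]: "restarts_ge (Suc j) 0 n x = 0"
  by (simp add: restarts_ge_def)

lemma restarts_ge_Suc_Suc:
  "restarts_ge (Suc j) (Suc N) n x =
    (\<integral>y. restarts_ge (if snd (snd y) then j else Suc j) N (Suc n) y \<partial>RK n x)"
proof -
  have "restarts_ge (Suc j) (Suc N) n x = (\<integral>y. measure (chain_from RK (Suc n) y)
     {r. r 0 = y \<and> Suc j \<le> (\<Sum>i<Suc N. of_bool (snd (snd (case_nat x r (Suc i)))))} \<partial>RK n x)"
    unfolding restarts_ge_def by (rule measure_chain_from_step) (rule pred_restarts)
  also have "(\<lambda>y. measure (chain_from RK (Suc n) y)
     {r. r 0 = y \<and> Suc j \<le> (\<Sum>i<Suc N. of_bool (snd (snd (case_nat x r (Suc i)))))}) =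
     (\<lambda>y. restarts_ge (if snd (snd y) then j else Suc j) N (Suc n) y)"
  proof (intro ext)
    fix y
    have split: "(\<Sum>i<Suc N. of_bool (snd (snd (case_nat x r (Suc i)))) :: nat) =
        of_bool (snd (snd (r 0))) + (\<Sum>i<N. of_bool (snd (snd (r (Suc i)))))" for r
      by (simp add: sum.lessThan_Suc_shift del: sum.lessThan_Suc)
    show "measure (chain_from RK (Suc n) y)
        {r. r 0 = y \<and> Suc j \<le> (\<Sum>i<Suc N. of_bool (snd (snd (case_nat x r (Suc i)))))} =
      restarts_ge (if snd (snd y) then j else Suc j) N (Suc n) y"
      unfolding restarts_ge_def split
    proof (rule chain_from_start_cong)
      show "Measurable.pred path_space (\<lambda>r. r 0 = y \<and>
         Suc j \<le> of_bool (snd (snd (r 0))) + (\<Sum>i<N. of_bool (snd (snd (r (Suc i)))) :: nat))"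
        unfolding split[symmetric] by (intro pred_intros_logic) (auto intro: pred_restarts)
    qed (auto intro: pred_restarts)
  qed
  finally show ?thesis .
qed

text \<open>The factor \<open>1 - safe\<close> strengthens the geometric bound so that it goes through by induction on
  the horizon \<open>N\<close>: by the one-step equation of \<open>safe\<close> it is the probability of a first restart.\<close>

lemma restarts_ge_le:
  assumes c: "0 \<le> c" "c \<le> 1"
    and avg: "\<And>m. m > n \<Longrightarrow> c \<le> (\<Sum>p\<in>reachable m. A.safe u m p) / card (reachable m)"
    and q: "q \<in> reachable n"
  shows "restarts_ge (Suc j) N n (conf n q b) \<le> (1 - c) ^ j * (1 - A.safe u n q)"
  using avg q
proof (induction N arbitrary: j n q b)
  case 0
  then show ?case using c by (simp add: A.safe_le_1)
next
  case (Suc N)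
  have q: "q \<in> states A" using Suc.prems reachable_subset by auto
  let ?R = "reachable (Suc n)"
  have card: "card ?R > 0" using finite_reachable[of "Suc n"] reachable_nonempty[of "Suc n"] by (simp add: card_gt_0_iff del: A.reach.simps)
  have IH: "restarts_ge (Suc j) N (Suc n) (conf (Suc n) p b) \<le> (1 - c) ^ j * (1 - A.safe u (Suc n) p)"
    if "p \<in> ?R" for j p b
    using Suc.prems that by (intro Suc.IH) auto
  \<comment> \<open>After a restart the factor \<open>1 - A.safe\<close> is averaged over the
    reachable states; by \<open>avg\<close> the average is at most \<open>1 - c\<close>, which
    accounts for one more power.\<close>
  have restart: "(\<Sum>p\<in>?R. restarts_ge j N (Suc n) (conf (Suc n) p True)) / card ?R \<le> (1 - c) ^ j" (is "?S \<le> _")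
  proof (cases j)
    case 0
    then show ?thesis using card by (simp del: A.reach.simps)
  next
    case (Suc j')
    then have "?S \<le> (\<Sum>p\<in>?R. (1 - c) ^ j' * (1 - A.safe u (Suc n) p)) / card ?R"
      using IH by (intro divide_right_mono sum_mono) auto
    also have "\<dots> = (1 - c) ^ j' * (1 - (\<Sum>p\<in>?R. A.safe u (Suc n) p) / card ?R)"
      using card by (simp add: sum_subtractf sum_distrib_left[symmetric] field_simps del: A.reach.simps)
    also have "\<dots> \<le> (1 - c) ^ j' * (1 - c)"
      using Suc.prems(1)[of "Suc n"] c by (intro mult_left_mono) (auto simp del: A.reach.simps)
    finally show ?thesis using Suc by (simp add: mult.commute)
  qed
  let ?P = "pmf (trans A q (w n))"
  have "restarts_ge (Suc j) (Suc N) n (conf n q b) = (\<Sum>q'\<in>states A. ?P q' *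
      (if u < weight A q (w n) q' then restarts_ge (Suc j) N (Suc n) (conf (Suc n) q' False) else ?S))"
    unfolding restarts_ge_Suc_Suc integral_RK[OF Suc.prems(2)]
    by (simp add: conf_def cong: if_cong del: A.reach.simps)
  also have "\<dots> \<le> (\<Sum>q'\<in>states A. ?P q' *
      ((1 - c) ^ j * (1 - (if u < weight A q (w n) q' then A.safe u (Suc n) q' else 0))))"
  proof (rule sum_mono)
    fix q'
    show "?P q' * (if u < weight A q (w n) q' then restarts_ge (Suc j) N (Suc n) (conf (Suc n) q' False) else ?S) \<le>
       ?P q' * ((1 - c) ^ j * (1 - (if u < weight A q (w n) q' then A.safe u (Suc n) q' else 0)))"
    proof (cases "q' \<in> set_pmf (trans A q (w n))")
      case True
      then have "q' \<in> ?R" using Suc.prems(2) by auto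
      with restart IH show ?thesis by (intro mult_left_mono) (auto simp del: A.reach.simps)
    qed (simp add: set_pmf_iff)
  qed
  also have "\<dots> = (1 - c) ^ j * ((\<Sum>q'\<in>states A. ?P q') - A.safe u n q)"
  proof -
    have "p * ((1 - c) ^ j * (1 - x)) = (1 - c) ^ j * (p - p * x)" for p x :: real
      by (simp add: algebra_simps)
    then show ?thesis
      unfolding A.safe_step[OF q] by (simp only: sum_distrib_left[symmetric] sum_subtractf)
  qed
  also have "(\<Sum>q'\<in>states A. ?P q') = 1"
    using A.K_closed[OF q] finite_states by (simp add: sum_pmf_eq_1)
  finally show ?case .
qed

lemma frequently_restarts:
  assumes "\<not> (\<forall>\<^sub>F i in sequentially. \<not> b i)"
  shows "\<exists>N. j \<le> (\<Sum>i<N. of_bool (b i) :: nat)"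
proof (induction j)
  case (Suc j)
  then obtain N where N: "j \<le> (\<Sum>i<N. of_bool (b i) :: nat)" by auto
  from assms obtain i where i: "i \<ge> N" "b i" unfolding eventually_sequentially by blast
  have "(\<Sum>i<N. of_bool (b i) :: nat) \<le> (\<Sum>i<i. of_bool (b i))"
    using i(1) by (intro sum_mono2) auto
  with N i(2) have "Suc j \<le> (\<Sum>i<Suc i. of_bool (b i) :: nat)" by simp
  then show ?case by blast
qed auto

text \<open>Infinitely many restarts imply at least \<open>j + 1\<close> of them for every
  \<open>j\<close>, which has probability at most \<open>(1 - c) ^ j\<close> by the geometric
  bound.\<close>

lemma R_ev_safe_late:
  assumes half: "\<And>m. m \<ge> n \<Longrightarrow> \<exists>q\<in>reachable m. A.safe u m q > 1 / 2" and q: "q \<in> reachable n"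
  shows "R.ev_safe n (conf n q b) = 1"
proof -
  let ?x = "conf n q b"
  interpret prob_space "chain_from RK n ?x" by (rule prob_space_chain_from)
  \<comment> \<open>A uniform restart picks the state that is safe with probability above 1/2 with
    probability at least \<open>1 / card (states A)\<close>.\<close>
  define c where "c = 1 / (2 * real (card (states A)))"
  have card: "card (states A) > 0"
    using q reachable_subset finite_states by (auto simp: card_gt_0_iff)
  then have c: "0 < c" "c \<le> 1" by (auto simp: c_def field_simps)
  have avg: "c \<le> (\<Sum>p\<in>reachable m. A.safe u m p) / card (reachable m)" if "m > n" for m
  proof -
    have "\<exists>p\<in>reachable m. A.safe u m p > 1 / 2" using that by (intro half) simp
    then obtain p where p: "p \<in> reachable m" "A.safe u m p > 1 / 2" by (elim bexE)
    have "1 / 2 \<le> (\<Sum>p\<in>reachable m. A.safe u m p)"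
      using p(2) member_le_sum[of p "reachable m" "A.safe u m", OF p(1) A.safe_nonneg finite_reachable]
      by linarith
    moreover have "0 < card (reachable m)" "card (reachable m) \<le> card (states A)"
      using finite_reachable[of m] reachable_nonempty[of m] reachable_subset[of m] finite_states
      by (auto simp: card_gt_0_iff card_mono)
    ultimately have "1 / 2 / real (card (states A)) \<le> (\<Sum>p\<in>reachable m. A.safe u m p) / card (reachable m)"
      by (intro frac_le) auto
    then show ?thesis by (simp add: c_def)
  qed
  let ?C = "\<lambda>N r. \<Sum>i<N. of_bool (snd (snd (r (Suc i) :: nat \<times> nat \<times> bool))) :: nat"
  have bound: "1 - R.ev_safe n ?x \<le> (1 - c) ^ j" for j
  proof -
    have C: "{r. Suc j \<le> ?C N r} \<in> sets path_space" for N
      by (rule Collect_in_path_space) measurable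
    have mono: "?C M r \<le> ?C N r" if "M \<le> N" for M N r
      using that by (intro sum_mono2) auto
    have "(\<lambda>N. restarts_ge (Suc j) N n ?x) \<longlonglongrightarrow> prob (\<Union>N. {r. Suc j \<le> ?C N r})"
      unfolding restarts_ge_def
    proof (rule finite_Lim_measure_incseq)
      show "incseq (\<lambda>N. {r. Suc j \<le> ?C N r})"
        by (auto simp only: incseq_def intro: order_trans[OF _ mono])
    qed (use C in auto)
    moreover have "restarts_ge (Suc j) N n ?x \<le> (1 - c) ^ j" for N
      using restarts_ge_le[OF _ c(2) avg q, of j N b] c mult_left_le[of "1 - A.safe u n q" "(1 - c) ^ j"]
      by fastforce
    ultimately have le: "prob (\<Union>N. {r. Suc j \<le> ?C N r}) \<le> (1 - c) ^ j"
      by (intro LIMSEQ_le_const2) auto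
    have E: "{r. \<forall>\<^sub>F i in sequentially. \<not> snd (snd (r (Suc i) :: nat \<times> nat \<times> bool))} \<in> sets path_space"
      by (rule Collect_in_path_space) (rule pred_eventually_step)
    have "1 - R.ev_safe n ?x = prob (UNIV - {r. \<forall>\<^sub>F i in sequentially. \<not> snd (snd (r (Suc i)))})"
      unfolding R.ev_safe_def using prob_compl[of "{r. \<forall>\<^sub>F i in sequentially. \<not> snd (snd (r (Suc i)))}"] E
      by simp
    also have "\<dots> \<le> prob (\<Union>N. {r. Suc j \<le> ?C N r})"
    proof (rule finite_measure_mono)
      show "UNIV - {r. \<forall>\<^sub>F i in sequentially. \<not> snd (snd (r (Suc i)))} \<subseteq> (\<Union>N. {r. Suc j \<le> ?C N r})"
      proof
        fix r assume "r \<in> UNIV - {r. \<forall>\<^sub>F i in sequentially. \<not> snd (snd (r (Suc i) :: nat \<times> nat \<times> bool))}"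
        then have "\<exists>N. Suc j \<le> ?C N r" by (intro frequently_restarts) simp
        then obtain N where "Suc j \<le> ?C N r" ..
        then have "r \<in> {r. Suc j \<le> ?C N r}" unfolding mem_Collect_eq .
        then show "r \<in> (\<Union>N. {r. Suc j \<le> ?C N r})" by (rule UN_I[OF UNIV_I])
      qed
      have "range (\<lambda>N. {r. Suc j \<le> ?C N r}) \<subseteq> events"
        unfolding sets_chain_from by (rule image_subsetI) (rule C)
      then show "(\<Union>N. {r. Suc j \<le> ?C N r}) \<in> events"
        by (rule sets.countable_UN)
    qed
    finally show ?thesis using le by simp
  qed
  have "(\<lambda>j. (1 - c) ^ j) \<longlonglongrightarrow> 0" using c by (intro LIMSEQ_realpow_zero) auto
  then have "1 - R.ev_safe n ?x \<le> 0"
    using bound by (intro LIMSEQ_le_const) auto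
  moreover have "R.ev_safe n ?x \<le> 1" by (simp add: R.ev_safe_def)
  ultimately show ?thesis by simp
qed

lemma set_pmf_RK_conf:
  assumes "q \<in> reachable n" "y \<in> set_pmf (RK n (conf n q b))"
  shows "\<exists>p\<in>reachable (Suc n). \<exists>b. y = conf (Suc n) p b"
proof -
  have "set_pmf (pmf_of_set (reachable (Suc n))) = reachable (Suc n)"
    by (intro set_pmf_of_set finite_reachable reachable_nonempty)
  moreover have "set_pmf (trans A q (w n)) \<subseteq> reachable (Suc n)" using assms(1) by auto
  ultimately show ?thesis
    using assms(2) unfolding RK_conf by (auto simp del: A.reach.simps split: if_splits)
qed

lemma R_reach:
  assumes "y \<in> R.reach (set_pmf (restart_init A)) n"
  shows "\<exists>q\<in>reachable n. \<exists>b. y = conf n q b"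
  using assms
proof (induction n arbitrary: y)
  case 0
  then show ?case by (auto simp: restart_init_def conf_def)
next
  case (Suc n)
  then obtain x where x: "x \<in> R.reach (set_pmf (restart_init A)) n" "y \<in> set_pmf (RK n x)" by auto
  with Suc.IH obtain q b where "q \<in> reachable n" "x = conf n q b" by blast
  with x(2) set_pmf_RK_conf show ?case by blast
qed

text \<open>The bound 1/2 is available only from some time on. Whether restarts are finitely many
  does not depend on a finite prefix, so averaging over successors carries probability 1
  back.\<close>

lemma R_ev_safe_back:
  assumes late: "\<And>q b. q \<in> reachable (n + k) \<Longrightarrow> R.ev_safe (n + k) (conf (n + k) q b) = 1"
    and q: "q \<in> reachable n"
  shows "R.ev_safe n (conf n q b) = 1"
  using late q
proof (induction k arbitrary: n q b)
  case (Suc k)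
  have x: "conf n q b \<in> restart_states A" using conf_in_restart_states[OF Suc.prems(2)] .
  have "R.ev_safe (Suc n) y = 1" if "y \<in> set_pmf (RK n (conf n q b))" for y
    using set_pmf_RK_conf[OF Suc.prems(2) that] Suc.IH[of "Suc n"] Suc.prems(1)
    by (auto simp del: A.reach.simps)
  then have eq: "pmf (RK n (conf n q b)) y * R.ev_safe (Suc n) y = pmf (RK n (conf n q b)) y" for y
    by (cases "y \<in> set_pmf (RK n (conf n q b))") (auto simp: set_pmf_iff)
  show ?case
    unfolding R.ev_safe_step[OF x] eq using R.K_closed[OF x] R.finite_St by (simp add: sum_pmf_eq_1)
qed simp

lemma restart_init_closed: "set_pmf (restart_init A) \<subseteq> restart_states A"
  using conf_in_restart_states[of _ 0 False] by (auto simp: restart_init_def conf_def)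

text \<open>From left to right, a positive probability already yields a reachable configuration with
  positive safety, which \<open>R_safe\<close> transfers to \<open>A\<close>. From right to left,
  safety above 1/2 at all late times gives probability 1 there, and this is carried back to time
  0.\<close>

theorem restart_correct:
  "measure (chain (restart_init A) RK) {r. \<forall>\<^sub>F n in sequentially. \<not> snd (snd (r (Suc n)))} = 1 \<longleftrightarrow>
   measure (run_measure A w) {r. \<forall>\<^sub>F n in sequentially. u < weight A (r n) (w n) (r (Suc n))} > 0"
    (is "?R = 1 \<longleftrightarrow> ?P > 0")
proof
  assume "?R = 1"
  then have "?R > 0" by simp
  then obtain n x where "x \<in> R.reach (set_pmf (restart_init A)) n" "R.safe n x > 0"
    using R.ev_safe_pos_iff[OF restart_init_closed] by auto
  then obtain q where "q \<in> reachable n" "A.safe u n q > 0"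
    using R_reach R_safe by (metis (no_types, lifting))
  then show "?P > 0" unfolding pos_iff_reachable_safe by blast
next
  assume "?P > 0"
  then obtain n q where q: "q \<in> reachable n" "A.safe u n q > 0"
    unfolding pos_iff_reachable_safe by blast
  obtain N where N: "\<And>m. m \<ge> N \<Longrightarrow> \<exists>q\<in>reachable m. A.safe u m q > 1 / 2"
    using A.safe_tends_to_1[OF init_subset q, of "1 / 2"] by auto
  have ev: "R.ev_safe 0 x = 1" if x: "x \<in> set_pmf (restart_init A)" for x
  proof -
    obtain q where "q \<in> reachable 0" "x = conf 0 q False"
      using x by (auto simp: restart_init_def conf_def)
    then show ?thesis using R_ev_safe_back[of 0 N q False] R_ev_safe_late[of N] N by auto
  qed
  have "{r. \<forall>\<^sub>F n in sequentially. \<not> snd (snd (r (Suc n) :: nat \<times> nat \<times> bool))} \<in> sets path_space"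
    by (rule Collect_in_path_space) (rule pred_eventually_step)
  then have "?R = (\<Sum>x\<in>restart_states A. pmf (restart_init A) x * R.ev_safe 0 x)"
    by (simp add: R.measure_chain_eq_sum[OF restart_init_closed] R.ev_safe_def)
  also have "\<dots> = (\<Sum>x\<in>restart_states A. pmf (restart_init A) x)"
    using ev by (intro sum.cong) (auto simp: set_pmf_iff)
  also have "\<dots> = 1" using restart_init_closed R.finite_St by (simp add: sum_pmf_eq_1)
  finally show "?R = 1" .
qed

end

lemma as_recognizable_restart:
  assumes "finite \<Sigma>" "wf_pwa \<Sigma> A" "u \<le> M"
  shows "as_recognizable False \<Sigma> (\<lambda>w.
    if measure (run_measure A w) {r. \<forall>\<^sub>F n in sequentially. u < weight A (r n) (w n) (r (Suc n))} > 0
    then real_of_rat M else real_of_rat u)"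
proof (rule as_recognizable_two_valued[where St="restart_states A" and i="restart_init A"
      and t="restart_trans A u" and bad="\<lambda>_ _ y. snd (snd y)"])
  show "set_pmf (restart_init A) \<subseteq> restart_states A"
    using assms(2) finite_subset[of "set_pmf (init A)" "states A"]
    by (auto simp: wf_pwa_def restart_init_def restart_states_def)
  show "measure (chain (restart_init A) (\<lambda>n q. restart_trans A u q (w n)))
      {r. \<forall>\<^sub>F n in sequentially. \<not> snd (snd (r (Suc n)))} = 1 \<longleftrightarrow>
    measure (run_measure A w) {r. \<forall>\<^sub>F n in sequentially. u < weight A (r n) (w n) (r (Suc n))} > 0"
    if "is_word \<Sigma> w" for w
  proof -
    interpret restart \<Sigma> A w u
      by unfold_locales (use assms that in auto)
    show ?thesis by (rule restart_correct)
  qed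
  show "set_pmf (restart_trans A u x \<sigma>) \<subseteq> restart_states A" if "x \<in> restart_states A" "\<sigma> \<in> \<Sigma>" for x \<sigma>
    using restart_trans_closed[OF assms(2) that(2,1)] .
qed (use assms in \<open>auto simp: wf_pwa_def intro!: finite_restart_states\<close>)

section \<open>The breakpoint automaton\<close>

text \<open>In a pair \<open>(S, B)\<close>, \<open>S\<close> is the set of reachable states and \<open>B\<close> consists of the endpoints of runs
  with weights above \<open>u\<close> since \<open>B\<close> was last empty and was refilled with all of \<open>S\<close>.\<close>

definition breakpoint_step :: "'a pwa \<Rightarrow> rat \<Rightarrow> nat set \<times> nat set \<Rightarrow> 'a \<Rightarrow> nat set \<times> nat set" where
  "breakpoint_step A u x \<sigma> = (post A (fst x) \<sigma>,
     if snd x = {} then post A (fst x) \<sigma>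
     else (\<Union>q\<in>snd x. {q' \<in> set_pmf (trans A q \<sigma>). u < weight A q \<sigma> q'}))"

text \<open>Sets of naturals form an uncountable type, while chains are built over countable types
  of states.\<close>

definition encode_pair :: "nat set \<times> nat set \<Rightarrow> nat \<times> nat" where
  "encode_pair x = (set_encode (fst x), set_encode (snd x))"

definition decode_pair :: "nat \<times> nat \<Rightarrow> nat set \<times> nat set" where
  "decode_pair x = (set_decode (fst x), set_decode (snd x))"

lemma decode_encode_pair: "finite (fst x) \<Longrightarrow> finite (snd x) \<Longrightarrow> decode_pair (encode_pair x) = x"
  by (simp add: decode_pair_def encode_pair_def)

context pwa_word
begin

definition breakpoint :: "rat \<Rightarrow> nat \<Rightarrow> nat set \<times> nat set" where
  "breakpoint u = rec_nat (set_pmf (init A), {}) (\<lambda>n x. breakpoint_step A u x (w n))"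

lemma breakpoint_0: "breakpoint u 0 = (set_pmf (init A), {})"
  and breakpoint_Suc: "breakpoint u (Suc n) = breakpoint_step A u (breakpoint u n) (w n)"
  by (simp_all add: breakpoint_def)

lemma fst_breakpoint: "fst (breakpoint u n) = reachable n"
  by (induction n) (simp_all add: breakpoint_0 breakpoint_Suc breakpoint_step_def post_def)

lemma snd_breakpoint_Suc:
  "snd (breakpoint u (Suc n)) = (if snd (breakpoint u n) = {} then reachable (Suc n)
     else (\<Union>q\<in>snd (breakpoint u n). {q' \<in> set_pmf (trans A q (w n)). u < weight A q (w n) q'}))"
  by (simp add: breakpoint_Suc breakpoint_step_def reachable_Suc fst_breakpoint del: A.reach.simps)

lemma snd_breakpoint_subset: "snd (breakpoint u n) \<subseteq> reachable n"
proof (induction n)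
  case (Suc n)
  then show ?case by (auto simp: snd_breakpoint_Suc)
qed (simp add: breakpoint_0)

lemma finite_breakpoint: "finite (fst (breakpoint u n))" "finite (snd (breakpoint u n))"
  using finite_reachable[of n] snd_breakpoint_subset[of u n]
  by (auto simp: fst_breakpoint intro: finite_subset)

lemma run_prefix:
  assumes "q \<in> reachable n"
  shows "\<exists>r. r n = q \<and> r 0 \<in> set_pmf (init A) \<and> (\<forall>i<n. r (Suc i) \<in> set_pmf (trans A (r i) (w i)))"
  using assms
proof (induction n arbitrary: q)
  case (Suc n)
  then obtain p where p: "p \<in> reachable n" "q \<in> set_pmf (trans A p (w n))" by auto
  with Suc.IH obtain r where r: "r n = p" "r 0 \<in> set_pmf (init A)"
    "\<And>i. i < n \<Longrightarrow> r (Suc i) \<in> set_pmf (trans A (r i) (w i))" by blast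
  then show ?case using p by (intro exI[of _ "r(Suc n := q)"]) (auto simp: less_Suc_eq)
qed auto

lemma is_run_iff: "is_run A w r \<longleftrightarrow> r 0 \<in> set_pmf (init A) \<and> (\<forall>i. r (Suc i) \<in> set_pmf (trans A (r i) (w i)))"
  by (simp add: is_run_def pmf_positive_iff)

lemma run_reachable: "is_run A w r \<Longrightarrow> r n \<in> reachable n"
  by (induction n) (auto simp: is_run_iff)

lemma run_append:
  assumes q: "r 0 \<in> reachable n" and r: "\<And>i. r (Suc i) \<in> set_pmf (trans A (r i) (w (n + i)))"
  shows "\<exists>s. is_run A w s \<and> (\<forall>i. s (n + i) = r i)"
proof -
  obtain p where p: "p n = r 0" "p 0 \<in> set_pmf (init A)" "\<And>i. i < n \<Longrightarrow> p (Suc i) \<in> set_pmf (trans A (p i) (w i))"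
    using run_prefix[OF q] by blast
  let ?s = "\<lambda>i. if i < n then p i else r (i - n)"
  have "?s (Suc i) \<in> set_pmf (trans A (?s i) (w i))" for i
  proof (cases "Suc i < n")
    case False
    then show ?thesis
    proof (cases "i < n")
      case True
      with False have "n = Suc i" by simp
      then show ?thesis using p(1) p(3)[of i] by simp
    next
      case False
      then show ?thesis using r[of "i - n"] by (simp add: Suc_diff_le)
    qed
  qed (use p in auto)
  moreover have "?s 0 \<in> set_pmf (init A)" using p by (cases n) auto
  ultimately show ?thesis by (intro exI[of _ ?s]) (auto simp: is_run_iff)
qed

text \<open>If the second component becomes empty once the run has passed its last bad weight, the
  refill catches the run, which then stays in it forever.\<close>

lemma breakpoint_of_run:
  assumes r: "is_run A w r" and ev: "\<forall>\<^sub>F n in sequentially. u < weight A (r n) (w n) (r (Suc n))"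
  shows "\<forall>\<^sub>F n in sequentially. snd (breakpoint u n) \<noteq> {}"
proof (rule ccontr)
  assume neg: "\<not> ?thesis"
  obtain N where N: "\<And>n. n \<ge> N \<Longrightarrow> u < weight A (r n) (w n) (r (Suc n))"
    using ev by (auto simp: eventually_sequentially)
  obtain m where m: "m \<ge> N" "snd (breakpoint u m) = {}"
    using neg unfolding eventually_sequentially by blast
  have "r n \<in> snd (breakpoint u n)" if "n \<ge> Suc m" for n
    using that
  proof (induction n rule: dec_induct)
    case base
    then show ?case using m run_reachable[OF r, of "Suc m"] by (simp add: snd_breakpoint_Suc del: A.reach.simps)
  next
    case (step n)
    then show ?case using N[of n] m r by (auto simp: snd_breakpoint_Suc is_run_iff)
  qed
  then have "\<forall>\<^sub>F n in sequentially. snd (breakpoint u n) \<noteq> {}"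
    by (auto simp: eventually_sequentially intro!: exI[of _ "Suc m"])
  with neg show False ..
qed

text \<open>Prepares the Koenig argument: by pigeonhole over the finitely many successors, a state
  alive for all \<open>k\<close> has a good successor alive for all \<open>k\<close>.\<close>

primrec alive :: "rat \<Rightarrow> nat \<Rightarrow> nat \<Rightarrow> nat \<Rightarrow> bool" where
  "alive u 0 n q \<longleftrightarrow> True"
| "alive u (Suc k) n q \<longleftrightarrow> (\<exists>q'\<in>set_pmf (trans A q (w n)). u < weight A q (w n) q' \<and> alive u k (Suc n) q')"

lemma alive_mono: "alive u k n q \<Longrightarrow> l \<le> k \<Longrightarrow> alive u l n q"
proof (induction l arbitrary: k n q)
  case (Suc l)
  then obtain k' where "k = Suc k'" by (cases k) auto
  with Suc show ?case by auto
qed simp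

lemma alive_pigeonhole:
  assumes "finite X" and "\<And>k. \<exists>q\<in>X. alive u k n q"
  shows "\<exists>q\<in>X. \<forall>k. alive u k n q"
proof (rule ccontr)
  assume "\<not> ?thesis"
  then obtain f where f: "\<And>q. q \<in> X \<Longrightarrow> \<not> alive u (f q) n q" by metis
  obtain q where q: "q \<in> X" "alive u (Max (f ` X)) n q" using assms(2) by blast
  then have "alive u (f q) n q" using assms(1) by (intro alive_mono[OF q(2)]) auto
  with f q(1) show False by blast
qed

lemma run_of_breakpoint:
  assumes "\<forall>\<^sub>F n in sequentially. snd (breakpoint u n) \<noteq> {}"
  shows "\<exists>r. is_run A w r \<and> (\<forall>\<^sub>F n in sequentially. u < weight A (r n) (w n) (r (Suc n)))"
proof -
  obtain N where N: "\<And>n. n \<ge> N \<Longrightarrow> snd (breakpoint u n) \<noteq> {}"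
    using assms by (auto simp: eventually_sequentially)
  \<comment> \<open>When the second component is no longer refilled, each of its later elements has
    a predecessor in it; going back from time \<open>n + k\<close> gives a good path of length
    \<open>k\<close>.\<close>
  have "\<exists>q\<in>snd (breakpoint u n). alive u k n q" if "n \<ge> N" for k n
    using that
  proof (induction k arbitrary: n)
    case 0
    then show ?case using N by auto
  next
    case (Suc k)
    from Suc.IH[of "Suc n"] Suc.prems
    obtain q' where q': "q' \<in> snd (breakpoint u (Suc n))" "alive u k (Suc n) q'" by auto
    then show ?case using N[OF Suc.prems] by (auto simp: snd_breakpoint_Suc)
  qed
  then obtain q where q: "q \<in> snd (breakpoint u N)" "\<And>k. alive u k N q"
    using alive_pigeonhole[of "snd (breakpoint u N)" u N] finite_breakpoint by blast
  have "\<exists>r. \<forall>i. (r i \<in> reachable (N + i) \<and> (\<forall>k. alive u k (N + i) (r i))) \<and>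
     (r (Suc i) \<in> set_pmf (trans A (r i) (w (N + i))) \<and> u < weight A (r i) (w (N + i)) (r (Suc i)))"
  proof (rule dependent_nat_choice)
    show "\<exists>x. x \<in> reachable (N + 0) \<and> (\<forall>k. alive u k (N + 0) x)"
      using q snd_breakpoint_subset[of u N] by auto
    fix x i assume x: "x \<in> reachable (N + i) \<and> (\<forall>k. alive u k (N + i) x)"
    then have x': "set_pmf (trans A x (w (N + i))) \<subseteq> reachable (Suc (N + i))" by auto
    let ?X = "{y \<in> set_pmf (trans A x (w (N + i))). u < weight A x (w (N + i)) y}"
    have "\<exists>y\<in>?X. \<forall>k. alive u k (Suc (N + i)) y"
    proof (rule alive_pigeonhole)
      show "\<exists>y\<in>?X. alive u k (Suc (N + i)) y" for k
        using x[THEN conjunct2, rule_format, of "Suc k"] by auto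
      show "finite ?X"
        using x' finite_reachable[of "Suc (N + i)"] by (auto intro: finite_subset)
    qed
    then show "\<exists>y. (y \<in> reachable (N + Suc i) \<and> (\<forall>k. alive u k (N + Suc i) y)) \<and>
       (y \<in> set_pmf (trans A x (w (N + i))) \<and> u < weight A x (w (N + i)) y)"
      using x' by (auto simp del: A.reach.simps)
  qed
  then obtain r where r: "\<And>i. r i \<in> reachable (N + i)"
    "\<And>i. r (Suc i) \<in> set_pmf (trans A (r i) (w (N + i)))"
    "\<And>i. u < weight A (r i) (w (N + i)) (r (Suc i))"
    by blast
  obtain s where s: "is_run A w s" "\<And>i. s (N + i) = r i"
    using run_append[of r N] r(1)[of 0] r(2) by auto
  have "u < weight A (s n) (w n) (s (Suc n))" if "n \<ge> N" for n
    using s(2)[of "n - N"] s(2)[of "Suc (n - N)"] r(3)[of "n - N"] that by simp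
  then show ?thesis using s(1) by (auto simp: eventually_sequentially)
qed

lemma breakpoint_iff:
  "(\<forall>\<^sub>F n in sequentially. snd (breakpoint u n) \<noteq> {}) \<longleftrightarrow>
   (\<exists>r. is_run A w r \<and> (\<forall>\<^sub>F n in sequentially. u < weight A (r n) (w n) (r (Suc n))))"
  using breakpoint_of_run run_of_breakpoint by blast

end

lemma as_recognizable_breakpoint:
  assumes "finite \<Sigma>" "wf_pwa \<Sigma> A" "u \<le> M"
  shows "as_recognizable True \<Sigma> (\<lambda>w.
    if \<exists>r. is_run A w r \<and> (\<forall>\<^sub>F n in sequentially. u < weight A (r n) (w n) (r (Suc n)))
    then real_of_rat M else real_of_rat u)"
proof (rule as_recognizable_two_valued[where St="encode_pair ` (Pow (states A) \<times> Pow (states A))"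
      and i="return_pmf (encode_pair (set_pmf (init A), {}))"
      and t="\<lambda>x \<sigma>. return_pmf (encode_pair (breakpoint_step A u (decode_pair x) \<sigma>))"
      and bad="\<lambda>x _ _. snd (decode_pair x) = {}"])
  have fin: "finite (states A)" and init: "set_pmf (init A) \<subseteq> states A"
    using assms(2) by (auto simp: wf_pwa_def)
  show "finite (encode_pair ` (Pow (states A) \<times> Pow (states A)))"
    using fin by simp
  show "set_pmf (return_pmf (encode_pair (set_pmf (init A), {}))) \<subseteq> encode_pair ` (Pow (states A) \<times> Pow (states A))"
    using init by simp
  show "set_pmf (return_pmf (encode_pair (breakpoint_step A u (decode_pair x) \<sigma>)))
      \<subseteq> encode_pair ` (Pow (states A) \<times> Pow (states A))"
    if x_in: "x \<in> encode_pair ` (Pow (states A) \<times> Pow (states A))" and \<sigma>: "\<sigma> \<in> \<Sigma>" for x \<sigma>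
  proof -
    obtain y where y: "x = encode_pair y" "y \<in> Pow (states A) \<times> Pow (states A)"
      using x_in by blast
    obtain S B where x: "x = encode_pair (S, B)" and SB: "S \<subseteq> states A" "B \<subseteq> states A"
      using y by (cases y) auto
    then have "decode_pair x = (S, B)"
      using finite_subset[OF _ fin] by (simp add: decode_encode_pair)
    moreover have "post A S \<sigma> \<subseteq> states A" "post A B \<sigma> \<subseteq> states A"
      using post_subset[OF assms(2) \<sigma>] SB by auto
    ultimately have "breakpoint_step A u (decode_pair x) \<sigma> \<in> Pow (states A) \<times> Pow (states A)"
      by (auto simp: breakpoint_step_def post_def)
    then show ?thesis by simp
  qed
  fix w assume "is_word \<Sigma> w"
  then interpret pwa_word \<Sigma> A w by unfold_locales (use assms in auto)
  have "measure (chain (return_pmf (encode_pair (set_pmf (init A), {})))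
        (\<lambda>n q. return_pmf (encode_pair (breakpoint_step A u (decode_pair q) (w n)))))
      {r. \<forall>\<^sub>F n in sequentially. snd (decode_pair (r n)) \<noteq> {}} =
     of_bool (\<forall>\<^sub>F n in sequentially. snd (decode_pair (encode_pair (breakpoint u n))) \<noteq> {})"
  proof (rule measure_chain_deterministic)
    show "Measurable.pred path_space (\<lambda>r. \<forall>\<^sub>F n in sequentially. snd (decode_pair (r n)) \<noteq> {})"
      by (rule pred_eventually_step)
  qed (simp_all add: breakpoint_0 breakpoint_Suc decode_encode_pair finite_breakpoint)
  then show "measure (chain (return_pmf (encode_pair (set_pmf (init A), {})))
        (\<lambda>n q. return_pmf (encode_pair (breakpoint_step A u (decode_pair q) (w n)))))
      {r. \<forall>\<^sub>F n in sequentially. snd (decode_pair (r n)) \<noteq> {}} = 1 \<longleftrightarrow>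
      (\<exists>r. is_run A w r \<and> (\<forall>\<^sub>F n in sequentially. u < weight A (r n) (w n) (r (Suc n))))"
    by (simp add: decode_encode_pair finite_breakpoint breakpoint_iff)
qed (use assms in auto)

section \<open>Suprema over finitely many thresholds, and the two reductions\<close>

text \<open>Common pattern of the positive and the nondeterministic semantics:
  \<open>G \<eta>\<close> says that the threshold \<open>\<eta>\<close> is attained, and
  \<open>G_step\<close> rounds it up to a weight, so that \<open>Min_thresholds\<close> applies to
  the supremum.\<close>

locale threshold_sup =
  fixes W :: "real set" and G c :: "real \<Rightarrow> bool"
  assumes finite_W: "finite W" and W_nonempty: "W \<noteq> {}" and G_Min: "G (Min W)"
    and G_step: "G \<eta> \<Longrightarrow> \<exists>v\<in>W. \<eta> \<le> v \<and> G v"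
    and c_iff: "c u \<longleftrightarrow> (\<exists>\<eta>>u. G \<eta>)"
begin

lemma le_Max: "G \<eta> \<Longrightarrow> \<eta> \<le> Max W"
  using G_step finite_W by (meson Max_ge order_trans)

lemma bdd_above_G: "bdd_above {\<eta>. G \<eta>}"
  using le_Max by (intro bdd_aboveI[of _ "Max W"]) auto

lemma threshold_witness:
  assumes "c u"
  shows "\<exists>v\<in>W. u < v \<and> v \<le> Sup {\<eta>. G \<eta>}"
proof -
  obtain \<eta> v where "u < \<eta>" "v \<in> W" "\<eta> \<le> v" "G v" using assms G_step unfolding c_iff by blast
  then show ?thesis using bdd_above_G by (intro bexI[of _ v]) (auto intro: cSup_upper)
qed

lemma Sup_le: "\<not> c u \<Longrightarrow> Sup {\<eta>. G \<eta>} \<le> u"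
  using G_Min unfolding c_iff by (intro cSup_least) (auto simp: not_less)

lemma less_Sup_iff: "u < Sup {\<eta>. G \<eta>} \<longleftrightarrow> c u"
  using threshold_witness[of u] Sup_le[of u] by (cases "c u") auto

lemma Sup_eq_Min: "Sup {\<eta>. G \<eta>} = Min ((\<lambda>u. if c u then Max W else u) ` W)"
proof (rule Min_thresholds[OF finite_W W_nonempty])
  show "Min W \<le> Sup {\<eta>. G \<eta>}" using G_Min bdd_above_G by (intro cSup_upper) auto
  show "Sup {\<eta>. G \<eta>} \<le> Max W" using G_Min le_Max by (intro cSup_least) auto
qed (use threshold_witness Sup_le in auto)

end

context pwa_word
begin

lemma next_weight:
  obtains \<eta> where "u < \<eta>" "\<And>x. x \<in> weights \<Sigma> A \<Longrightarrow> u < x \<Longrightarrow> \<eta> \<le> x"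
proof
  \<comment> \<open>The element \<open>u + 1\<close> keeps the set nonempty when no weight exceeds
    \<open>u\<close>.\<close>
  define \<eta> where "\<eta> = Min (insert (u + 1) {x \<in> weights \<Sigma> A. u < x})"
  show "u < \<eta>" using finite_weights by (auto simp: \<eta>_def)
  show "\<eta> \<le> x" if "x \<in> weights \<Sigma> A" "u < x" for x
    using finite_weights that by (auto simp: \<eta>_def)
qed

lemma prob_gt_pos_iff:
  "measure (run_measure A w) {r. \<forall>\<^sub>F n in sequentially. u < step_weight A w r n} > 0 \<longleftrightarrow>
     (\<exists>\<eta>>u. prob_ge A w \<eta> > 0)" (is "?G > 0 \<longleftrightarrow> _")
proof
  obtain \<eta> where \<eta>: "u < \<eta>" "\<And>x. x \<in> weights \<Sigma> A \<Longrightarrow> u < x \<Longrightarrow> \<eta> \<le> x"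
    using next_weight[of u] by blast
  have "prob_ge A w \<eta> = ?G" unfolding prob_ge_def
  proof (rule measure_eq_AE)
    show "AE r in run_measure A w. r \<in> {r. \<forall>\<^sub>F n in sequentially. \<eta> \<le> step_weight A w r n} \<longleftrightarrow>
        r \<in> {r. \<forall>\<^sub>F n in sequentially. u < step_weight A w r n}"
      using AE_run_in_states
    proof eventually_elim
      case (elim r)
      then have "\<eta> \<le> step_weight A w r n \<longleftrightarrow> u < step_weight A w r n" for n
        using \<eta> step_weight_in_weights[of r n] by force
      then show ?case by simp
    qed
  qed (auto intro!: Collect_in_path_space pred_eventually_weight)
  then show "?G > 0 \<Longrightarrow> \<exists>\<eta>>u. prob_ge A w \<eta> > 0" using \<eta>(1) by auto
next
  assume "\<exists>\<eta>>u. prob_ge A w \<eta> > 0"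
  then obtain \<eta> where \<eta>: "u < \<eta>" "prob_ge A w \<eta> > 0" by blast
  interpret prob_space "run_measure A w" by (rule prob_space_run_measure)
  have "{r. \<forall>\<^sub>F n in sequentially. u < step_weight A w r n} \<in> sets path_space"
    by (rule Collect_in_path_space[OF pred_eventually_weight])
  then have "prob_ge A w \<eta> \<le> ?G" unfolding prob_ge_def
    by (intro finite_measure_mono) (use \<eta>(1) in \<open>auto elim!: eventually_mono\<close>)
  with \<eta>(2) show "?G > 0" by simp
qed

lemma pos_sem_thresholds:
  "threshold_sup (weights \<Sigma> A) (\<lambda>\<eta>. prob_ge A w \<eta> > 0) (\<lambda>u. measure (run_measure A w)
      {r. \<forall>\<^sub>F n in sequentially. u < step_weight A w r n} > 0)"
proof (rule threshold_sup.intro[OF finite_weights weights_nonempty])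
  show "\<exists>v\<in>weights \<Sigma> A. \<eta> \<le> v \<and> prob_ge A w v > 0" if "prob_ge A w \<eta> > 0" for \<eta>
    using prob_ge_posD[OF that] that by auto
qed (simp_all add: prob_ge_eq_1 prob_gt_pos_iff)

lemmas pos_sem_eq_Min = threshold_sup.Sup_eq_Min[OF pos_sem_thresholds, folded pos_sem_eq]

lemma pos_sem_gt_iff: "real_of_rat u < pos_sem A w \<longleftrightarrow> (\<exists>n. \<exists>q\<in>reachable n. A.safe u n q > 0)"
  using threshold_sup.less_Sup_iff[OF pos_sem_thresholds, of "real_of_rat u"]
  by (simp add: pos_sem_eq[symmetric] of_rat_less pos_iff_reachable_safe)

lemma run_in_states: "is_run A w r \<Longrightarrow> r n \<in> states A"
  using run_reachable reachable_subset by blast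

lemma ex_run: "\<exists>r. is_run A w r"
proof -
  obtain q where q: "q \<in> reachable 0" using reachable_nonempty by blast
  let ?r = "rec_nat q (\<lambda>n q. SOME p. p \<in> set_pmf (trans A q (w n)))"
  have "?r (Suc i) \<in> set_pmf (trans A (?r i) (w (0 + i)))" for i
    using some_in_eq set_pmf_not_empty by (simp add: some_in_eq set_pmf_not_empty)
  then show ?thesis using run_append[of ?r 0] q by auto
qed

lemma max_sem_eq_Sup:
  "max_sem A w = Sup {\<eta>. \<exists>r. is_run A w r \<and> (\<forall>\<^sub>F n in sequentially. \<eta> \<le> step_weight A w r n)}"
proof -
  have le: "\<eta> \<le> liminf_val A w r \<longleftrightarrow> (\<forall>\<^sub>F n in sequentially. \<eta> \<le> step_weight A w r n)"
    if "is_run A w r" for r \<eta>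
    using le_liminf_val_iff run_in_states[OF that] by blast
  let ?S = "{liminf_val A w r | r. is_run A w r}" and ?T = "{\<eta>. \<exists>r. is_run A w r \<and> \<eta> \<le> liminf_val A w r}"
  have "liminf_val A w r \<le> Max (weights \<Sigma> A)" if r: "is_run A w r" for r
  proof -
    have "\<forall>\<^sub>F n in sequentially. liminf_val A w r \<le> step_weight A w r n"
      using le[OF r] by blast
    then obtain n where "liminf_val A w r \<le> step_weight A w r n" by (auto simp: eventually_sequentially)
    also have "\<dots> \<le> Max (weights \<Sigma> A)"
      using finite_weights step_weight_in_weights run_in_states[OF r] by (intro Max_ge) auto
    finally show ?thesis .
  qed
  then have bdd: "bdd_above ?S" "bdd_above ?T"
    by (auto intro!: bdd_aboveI[of _ "Max (weights \<Sigma> A)"] intro: order_trans)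
  have "Sup ?S = Sup ?T"
  proof (rule antisym)
    show "Sup ?S \<le> Sup ?T" using ex_run bdd(2) by (intro cSup_subset_mono) auto
    show "Sup ?T \<le> Sup ?S"
    proof (rule cSup_least)
      fix \<eta> assume "\<eta> \<in> ?T"
      then obtain r where r: "is_run A w r" "\<eta> \<le> liminf_val A w r" by auto
      note r(2)
      also have "liminf_val A w r \<le> Sup ?S" using r(1) bdd(1) by (intro cSup_upper) auto
      finally show "\<eta> \<le> Sup ?S" .
    qed (use ex_run in auto)
  qed
  also have "?T = {\<eta>. \<exists>r. is_run A w r \<and> (\<forall>\<^sub>F n in sequentially. \<eta> \<le> step_weight A w r n)}"
    using le by blast
  finally show ?thesis by (simp add: max_sem_def)
qed

lemma max_sem_thresholds:
  "threshold_sup (weights \<Sigma> A)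
    (\<lambda>\<eta>. \<exists>r. is_run A w r \<and> (\<forall>\<^sub>F n in sequentially. \<eta> \<le> step_weight A w r n))
    (\<lambda>u. \<exists>r. is_run A w r \<and> (\<forall>\<^sub>F n in sequentially. u < step_weight A w r n))"
proof (rule threshold_sup.intro[OF finite_weights weights_nonempty])
  show "\<exists>r. is_run A w r \<and> (\<forall>\<^sub>F n in sequentially. Min (weights \<Sigma> A) \<le> step_weight A w r n)"
  proof -
    obtain r where r: "is_run A w r" using ex_run by blast
    then have "Min (weights \<Sigma> A) \<le> step_weight A w r n" for n
      using finite_weights step_weight_in_weights run_in_states by (intro Min_le) auto
    with r show ?thesis by (auto intro: always_eventually)
  qed
  show "\<exists>v\<in>weights \<Sigma> A. \<eta> \<le> v \<and> (\<exists>r. is_run A w r \<and> (\<forall>\<^sub>F n in sequentially. v \<le> step_weight A w r n))"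
    if \<eta>: "\<exists>r. is_run A w r \<and> (\<forall>\<^sub>F n in sequentially. \<eta> \<le> step_weight A w r n)" for \<eta>
  proof -
    obtain r where r: "is_run A w r" "\<forall>\<^sub>F n in sequentially. \<eta> \<le> step_weight A w r n"
      using \<eta> by blast
    have in_W: "step_weight A w r n \<in> weights \<Sigma> A" for n
      using step_weight_in_weights run_in_states[OF r(1)] by blast
    let ?V = "{v \<in> weights \<Sigma> A. \<eta> \<le> v}"
    have "?V \<noteq> {}" using r(2) in_W by (auto simp: eventually_sequentially)
    then have "Min ?V \<in> ?V" using finite_weights by (intro Min_in) auto
    moreover have "\<forall>\<^sub>F n in sequentially. Min ?V \<le> step_weight A w r n"
      using r(2) by eventually_elim (use in_W finite_weights in auto)
    ultimately show ?thesis using r(1) by auto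
  qed
  show "(\<exists>r. is_run A w r \<and> (\<forall>\<^sub>F n in sequentially. u < step_weight A w r n)) \<longleftrightarrow>
    (\<exists>\<eta>>u. \<exists>r. is_run A w r \<and> (\<forall>\<^sub>F n in sequentially. \<eta> \<le> step_weight A w r n))" for u
  proof safe
    fix r assume r: "is_run A w r" "\<forall>\<^sub>F n in sequentially. u < step_weight A w r n"
    obtain \<eta> where \<eta>: "u < \<eta>" "\<And>x. x \<in> weights \<Sigma> A \<Longrightarrow> u < x \<Longrightarrow> \<eta> \<le> x"
      using next_weight[of u] by blast
    have in_W: "step_weight A w r n \<in> weights \<Sigma> A" for n
      using step_weight_in_weights run_in_states[OF r(1)] by blast
    have "\<forall>\<^sub>F n in sequentially. \<eta> \<le> step_weight A w r n"
      using r(2) by eventually_elim (rule \<eta>(2)[OF in_W])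
    with r(1) \<eta>(1) show "\<exists>\<eta>>u. \<exists>r. is_run A w r \<and> (\<forall>\<^sub>F n in sequentially. \<eta> \<le> step_weight A w r n)"
      by blast
  next
    fix \<eta> r assume "u < \<eta>" "is_run A w r" "\<forall>\<^sub>F n in sequentially. \<eta> \<le> step_weight A w r n"
    then show "\<exists>r. is_run A w r \<and> (\<forall>\<^sub>F n in sequentially. u < step_weight A w r n)"
      by (intro exI[of _ r]) (auto elim: eventually_mono)
  qed
qed

lemmas max_sem_eq_Min = threshold_sup.Sup_eq_Min[OF max_sem_thresholds, folded max_sem_eq_Sup]
  and max_sem_gt_iff = threshold_sup.less_Sup_iff[OF max_sem_thresholds, folded max_sem_eq_Sup]

end

text \<open>The set of weights does not depend on the word, so one finite product of automata works
  for all words; \<open>w0\<close> guarantees that this set is nonempty.\<close>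

lemma as_recognizable_thresholds:
  assumes \<Sigma>: "finite \<Sigma>" and A: "wf_pwa \<Sigma> A" and word: "is_word \<Sigma> w0"
    and L: "\<And>w. is_word \<Sigma> w \<Longrightarrow>
      L w = Min ((\<lambda>u. if c u w then Max (weights \<Sigma> A) else u) ` weights \<Sigma> A)"
    and c: "\<And>u M. u \<le> M \<Longrightarrow> as_recognizable d \<Sigma>
      (\<lambda>w. if c (real_of_rat u) w then real_of_rat M else real_of_rat u)"
  shows "as_recognizable d \<Sigma> L"
proof -
  interpret pwa_word \<Sigma> A w0 using \<Sigma> A word by unfold_locales
  have rat: "\<exists>x. u = real_of_rat x" if "u \<in> weights \<Sigma> A" for u
    using that by (auto simp: weights_def)
  have "as_recognizable d \<Sigma> (\<lambda>w. Min ((\<lambda>u. if c u w then Max (weights \<Sigma> A) else u) ` weights \<Sigma> A))"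
  proof (rule as_recognizable_Min[OF \<Sigma> finite_weights weights_nonempty])
    fix u assume u: "u \<in> weights \<Sigma> A"
    obtain x y where xy: "u = real_of_rat x" "Max (weights \<Sigma> A) = real_of_rat y"
      using rat u Max_in[OF finite_weights weights_nonempty] by blast
    have "u \<le> Max (weights \<Sigma> A)" using u finite_weights by simp
    then have "x \<le> y" unfolding xy by (simp add: of_rat_less_eq)
    then show "as_recognizable d \<Sigma> (\<lambda>w. if c u w then Max (weights \<Sigma> A) else u)"
      unfolding xy by (rule c)
  qed
  then show ?thesis using L by (simp add: as_recognizable_def)
qed

theorem reducible_max_pos:
  assumes "finite \<Sigma>"
  shows "reducible \<Sigma> max_sem pos_sem"
  unfolding reducible_def
proof (intro allI impI)
  fix A :: "'a pwa" assume A: "wf_pwa \<Sigma> A"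
  show "\<exists>A'. wf_pwa \<Sigma> A' \<and> (\<forall>w. is_word \<Sigma> w \<longrightarrow> max_sem A w = pos_sem A' w)"
  proof (cases "\<exists>w. is_word \<Sigma> w")
    case True
    then obtain w0 where w0: "is_word \<Sigma> w0" by blast
    have "as_recognizable True \<Sigma> (max_sem A)"
    proof (rule as_recognizable_thresholds[OF assms A w0 pwa_word.max_sem_eq_Min])
      show "as_recognizable True \<Sigma> (\<lambda>w. if \<exists>r. is_run A w r \<and>
         (\<forall>\<^sub>F n in sequentially. real_of_rat u < step_weight A w r n) then real_of_rat M else real_of_rat u)"
        if "u \<le> M" for u M
        using as_recognizable_breakpoint[OF assms A that] by (simp add: of_rat_less)
    qed (use assms A in \<open>auto simp: pwa_word_def\<close>)
    then obtain B where B: "wf_pwa \<Sigma> B" "deterministic B" "\<And>w. is_word \<Sigma> w \<Longrightarrow> as_sem B w = max_sem A w"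
      unfolding as_recognizable_def by blast
    have "max_sem A w = pos_sem B w" if "is_word \<Sigma> w" for w
      using deterministic_pos_sem[of \<Sigma> B w] B that assms by (simp add: pwa_word_def)
    with B(1) show ?thesis by blast
  \<comment> \<open>Over the empty alphabet there is no word, and \<open>A\<close> itself
    serves.\<close>
  qed (use A in blast)
qed

theorem reducible_pos_as:
  assumes "finite \<Sigma>"
  shows "reducible \<Sigma> pos_sem as_sem"
  unfolding reducible_def
proof (intro allI impI)
  fix A :: "'a pwa" assume A: "wf_pwa \<Sigma> A"
  show "\<exists>A'. wf_pwa \<Sigma> A' \<and> (\<forall>w. is_word \<Sigma> w \<longrightarrow> pos_sem A w = as_sem A' w)"
  proof (cases "\<exists>w. is_word \<Sigma> w")
    case True
    then obtain w0 where w0: "is_word \<Sigma> w0" by blast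
    have "as_recognizable False \<Sigma> (pos_sem A)"
    proof (rule as_recognizable_thresholds[OF assms A w0 pwa_word.pos_sem_eq_Min])
      show "as_recognizable False \<Sigma> (\<lambda>w. if measure (run_measure A w)
         {r. \<forall>\<^sub>F n in sequentially. real_of_rat u < step_weight A w r n} > 0
         then real_of_rat M else real_of_rat u)"
        if "u \<le> M" for u M
        using as_recognizable_restart[OF assms A that] by (simp add: of_rat_less)
    qed (use assms A in \<open>auto simp: pwa_word_def\<close>)
    then obtain B where "wf_pwa \<Sigma> B" "\<And>w. is_word \<Sigma> w \<Longrightarrow> as_sem B w = pos_sem A w"
      unfolding as_recognizable_def by blast
    then show ?thesis by (intro exI[of _ B]) simp
  qed (use A in blast)
qed

section \<open>Strictness\<close>

definition gap_trans :: "nat \<Rightarrow> nat \<Rightarrow> nat pmf" where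
  "gap_trans q \<sigma> =
     (if q = 0 \<and> \<sigma> = 0 then pmf_of_set {0, 1}
      else if q = 1 \<and> \<sigma> = 0 then return_pmf 1
      else if q = 1 \<and> \<sigma> = 1 then return_pmf 0
      else return_pmf 2)"

text \<open>State 2 is a sink, entered if a block of letters 0 ends (by a letter 1) before the automaton
  has left state 0. A block of length \<open>k\<close> is thus survived with probability \<open>1 - (1/2)^k\<close>.\<close>

definition gap_pwa :: "nat pwa" where
  "gap_pwa = \<lparr>states = {0, 1, 2}, init = return_pmf 0, trans = gap_trans,
     weight = (\<lambda>q \<sigma> q'. if q' = 2 then 0 else 1)\<rparr>"

lemma gap_pwa_simps [simp]:
  "states gap_pwa = {0, 1, 2}" "init gap_pwa = return_pmf 0" "trans gap_pwa = gap_trans"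
  "weight gap_pwa q \<sigma> q' = (if q' = 2 then 0 else 1)"
  by (simp_all add: gap_pwa_def)

lemma wf_gap_pwa: "wf_pwa {0, 1} gap_pwa"
  by (auto simp: wf_pwa_def gap_trans_def)

locale gap_word = pwa_word "{0, 1}" gap_pwa w for w
begin

definition "S = A.safe (1/2)"
definition "SU = A.safe_upto (1/2)"

lemmas SU_tendsto = A.safe_upto_tendsto[of "1/2", folded S_def SU_def]
  and S_le_1 = A.safe_le_1[of "1/2", folded S_def]
  and S_nonneg = A.safe_nonneg[of "1/2", folded S_def]

lemma SU_0 [simp]: "SU 0 n q = 1"
  unfolding SU_def by (rule A.safe_upto_0)

lemma letter_cases: "w n = 0 \<or> w n = 1"
  using word by (auto simp: is_word_def)

lemma SU_Suc:
  "SU (Suc k) n 0 = (if w n = 0 then (SU k (Suc n) 0 + SU k (Suc n) 1) / 2 else 0)"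
  "SU (Suc k) n 1 = (if w n = 0 then SU k (Suc n) 1 else SU k (Suc n) 0)"
  "SU (Suc k) n 2 = 0"
  using letter_cases[of n] A.safe_upto_Suc[of _ "1/2" k n, folded SU_def]
  by (auto simp: gap_trans_def)

lemma S_step:
  "S n 0 = (if w n = 0 then (S (Suc n) 0 + S (Suc n) 1) / 2 else 0)"
  "S n 1 = (if w n = 0 then S (Suc n) 1 else S (Suc n) 0)"
  "S n 2 = 0"
  using letter_cases[of n] A.safe_step[of _ "1/2" n, folded S_def]
  by (auto simp: gap_trans_def)

lemma pos_sem_gap: "pos_sem gap_pwa w = (if \<exists>n. \<exists>q\<in>reachable n. S n q > 0 then 1 else 0)"
proof -
  have "(1 / 2 :: rat) < (if q = 2 then 0 else 1) \<longleftrightarrow> \<not> q = 2" for q :: nat by auto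
  then show ?thesis
    using two_valued_sem(2)[OF pwa_word_axioms, of 0 1 "\<lambda>_ _ q'. q' = 2"] pos_iff_reachable_safe[of "1/2", folded S_def]
    by simp
qed

end

text \<open>A pair \<open>(i, r)\<close> holds the number of the current block and the letters 0
  left in it. Block \<open>i\<close> has \<open>i + 2\<close> letters 0 and is closed by a letter 1,
  read when \<open>r\<close> is 0.\<close>

primrec growing_blocks :: "nat \<Rightarrow> nat \<times> nat" where
  "growing_blocks 0 = (0, 2)"
| "growing_blocks (Suc n) = (case growing_blocks n of (i, r) \<Rightarrow>
     if r = 0 then (Suc i, i + 3) else (i, r - 1))"

definition growing_word :: "nat \<Rightarrow> nat" where
  "growing_word n = (if snd (growing_blocks n) = 0 then 1 else 0)"

lemma growing_word_1_later: "\<exists>m\<ge>n. growing_word m = 1"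
proof -
  have "snd (growing_blocks (n + snd (growing_blocks n))) = 0"
  proof (induction "snd (growing_blocks n)" arbitrary: n)
    case (Suc r)
    then have "snd (growing_blocks (Suc n)) = r" by (auto split: prod.split)
    with Suc show ?case by (metis add_Suc_shift)
  qed simp
  then show ?thesis by (intro exI[of _ "n + snd (growing_blocks n)"]) (simp add: growing_word_def)
qed

lemma pos_sem_growing_word: "pos_sem gap_pwa growing_word = 1"
proof -
  interpret gap_word growing_word
    by unfold_locales (use wf_gap_pwa in \<open>auto simp: is_word_def growing_word_def\<close>)
  \<comment> \<open>Union bound: block \<open>j\<close> fails with probability
    \<open>(1/2) ^ (j + 2)\<close>, and over the blocks after the current one this sums to
    \<open>\<epsilon> n\<close>. From state 0, \<open>\<phi> n\<close> also subtracts the failure of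
    the current block. This gives \<open>\<phi> 0 = 1/2\<close>; blocks of length
    \<open>j + 1\<close> would give 0.\<close>
  define \<epsilon> where "\<epsilon> = (\<lambda>n. (1/2 :: real) ^ (fst (growing_blocks n) + 2))"
  define \<phi> where "\<phi> = (\<lambda>n. 1 - (1/2) ^ snd (growing_blocks n) - \<epsilon> n)"
  have "\<phi> n \<le> SU k n 0 \<and> 1 - \<epsilon> n \<le> SU k n 1" for k n
  proof (induction k arbitrary: n)
    case 0
    have "0 \<le> (1/2 :: real) ^ snd (growing_blocks n)" "0 \<le> \<epsilon> n" by (simp_all add: \<epsilon>_def)
    then show ?case by (simp only: SU_0 \<phi>_def) linarith
  next
    case (Suc k)
    obtain i r where ir: "growing_blocks n = (i, r)" by (cases "growing_blocks n")
    show ?case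
    proof (cases r)
      case 0
      then have "SU (Suc k) n 0 = 0" "SU (Suc k) n 1 = SU k (Suc n) 0"
        using ir by (simp_all add: SU_Suc growing_word_def del: One_nat_def)
      moreover have "\<phi> n \<le> 0" "1 - \<epsilon> n = \<phi> (Suc n)"
        using ir 0 by (simp_all add: \<phi>_def \<epsilon>_def power_add power3_eq_cube)
      ultimately show ?thesis using Suc.IH[of "Suc n"] by simp
    next
      case (Suc r')
      then have "SU (Suc k) n 0 = (SU k (Suc n) 0 + SU k (Suc n) 1) / 2" "SU (Suc k) n 1 = SU k (Suc n) 1"
        using ir by (simp_all add: SU_Suc growing_word_def del: One_nat_def)
      moreover have "\<phi> n = (\<phi> (Suc n) + (1 - \<epsilon> (Suc n))) / 2" "\<epsilon> (Suc n) = \<epsilon> n"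
        using ir Suc by (simp_all add: \<phi>_def \<epsilon>_def field_simps)
      ultimately show ?thesis using Suc.IH[of "Suc n"] by simp
    qed
  qed
  then have "\<phi> 0 \<le> S 0 0"
    by (intro LIMSEQ_le_const[OF SU_tendsto]) auto
  then have "S 0 0 > 0" by (simp add: \<phi>_def \<epsilon>_def power2_eq_square)
  moreover have "0 \<in> reachable 0" unfolding A.reach.simps by simp
  ultimately show ?thesis unfolding pos_sem_gap by auto
qed

text \<open>Safety at the times \<open>a + j * p\<close> does not depend on \<open>j\<close>, so
  safety arbitrarily close to 1 means safety equal to 1 in one of finitely many states. State 0
  would then still have safety 1 when the next letter 1 arrives, where it fails.\<close>

lemma pos_sem_gap_periodic:
  assumes w: "is_word {0, 1} w" and p: "p > 0" and per: "\<And>n. n \<ge> a \<Longrightarrow> w (n + p) = w n"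
    and one: "w a = 1"
  shows "pos_sem gap_pwa w = 0"
proof -
  interpret gap_word w by unfold_locales (use w wf_gap_pwa in auto)
  have "SU k (n + p) 0 = SU k n 0 \<and> SU k (n + p) 1 = SU k n 1" if "n \<ge> a" for k n
    using that
  proof (induction k arbitrary: n)
    case (Suc k)
    have "SU k (Suc (n + p)) 0 = SU k (Suc n) 0 \<and> SU k (Suc (n + p)) 1 = SU k (Suc n) 1"
      using Suc.IH[of "Suc n"] Suc.prems by simp
    with per[OF Suc.prems] show ?case by (simp add: SU_Suc del: One_nat_def)
  qed simp
  then have S_p: "S (n + p) 0 = S n 0" "S (n + p) 1 = S n 1" if "n \<ge> a" for n
    using that SU_tendsto[of "n + p"] SU_tendsto[of n]
    by (metis (lifting) LIMSEQ_unique ext)+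
  have S_jp: "S (a + j * p) q = S a q" if "q \<in> {0, 1, 2}" for j q
  proof (induction j)
    case (Suc j)
    have "S (a + Suc j * p) q = S (a + j * p + p) q" by (simp add: algebra_simps)
    also have "\<dots> = S (a + j * p) q" using that S_p[of "a + j * p"] by (auto simp: S_step(3))
    finally show ?case using Suc by simp
  qed simp
  have "\<not> (\<exists>n. \<exists>q\<in>reachable n. S n q > 0)"
  proof
    assume "\<exists>n. \<exists>q\<in>reachable n. S n q > 0"
    then obtain n q where nq: "q \<in> reachable n" "S n q > 0" by blast
    have near: "\<exists>q\<in>{0, 1, 2}. S a q > c" if "c < 1" for c
    proof -
      obtain N where N: "\<And>m. m \<ge> N \<Longrightarrow> \<exists>q\<in>reachable m. S m q > c"
        using A.safe_tends_to_1[OF init_subset nq[unfolded S_def] \<open>c < 1\<close>] by (auto simp: S_def)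
      have "N \<le> a + N * p" using p by (metis add_leD2 le_add2 mult.right_neutral mult_le_mono2 Suc_leI One_nat_def order_trans)
      then obtain q where "q \<in> reachable (a + N * p)" "S (a + N * p) q > c" using N by blast
      moreover have "q \<in> {0, 1, 2}" using calculation(1) reachable_subset by auto
      ultimately show ?thesis using S_jp by auto
    qed
    \<comment> \<open>On letter 1 the states 0 and 2 have safety 0, so only state 1 can come close
      to 1.\<close>
    have "S a 1 = 1"
    proof (rule ccontr)
      assume "S a 1 \<noteq> 1"
      then have "S a 1 < 1" using S_le_1[of a 1] by simp
      then show False using near[of "S a 1"] one S_nonneg[of a 1] by (auto simp: S_step(1)[of a] S_step(3))
    qed
    then have base: "S (Suc a) 0 = 1" using one S_step(2)[of a] by (simp del: One_nat_def)
    \<comment> \<open>Safety 1 excludes letter 1 here, and on letter 0 an average of two numbers at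
      most 1 equals 1 only if both do.\<close>
    have "S n 0 = 1" if "n \<ge> Suc a" for n
      using that
    proof (induction n rule: dec_induct)
      case (step n)
      then show ?case using S_le_1[of "Suc n" 0] S_le_1[of "Suc n" 1]
        by (auto simp: S_step(1)[of n] split: if_splits)
    qed (rule base)
    then have "S (a + p) 0 = 1" using p by simp
    moreover have "w (a + p) = 1" using per[of a] one by simp
    ultimately show False by (simp add: S_step(1)[of "a + p"])
  qed
  then show ?thesis unfolding pos_sem_gap by simp
qed

theorem not_reducible_pos_max: "\<not> reducible {0, 1 :: nat} pos_sem max_sem"
proof
  assume "reducible {0, 1 :: nat} pos_sem max_sem"
  then obtain A where A: "wf_pwa {0, 1} A"
    and eq: "\<And>w. is_word {0, 1 :: nat} w \<Longrightarrow> pos_sem gap_pwa w = max_sem A w"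
    unfolding reducible_def using wf_gap_pwa by blast
  let ?v = growing_word
  have v: "is_word {0, 1} ?v" by (auto simp: is_word_def growing_word_def)
  interpret V: pwa_word "{0, 1}" A ?v by unfold_locales (use A v in auto)
  have "1 / 2 < max_sem A ?v" using eq[OF v] pos_sem_growing_word by simp
  then obtain r where r: "is_run A ?v r" "\<forall>\<^sub>F n in sequentially. 1 / 2 < step_weight A ?v r n"
    unfolding V.max_sem_gt_iff by blast
  then obtain N where N: "\<And>n. n \<ge> N \<Longrightarrow> 1 / 2 < step_weight A ?v r n"
    by (auto simp: eventually_sequentially)
  let ?X = "{n. n \<ge> N \<and> ?v n = 1}"
  have "infinite ?X"
    unfolding infinite_nat_iff_unbounded_le
  proof
    fix m
    obtain n where "n \<ge> max m N" "?v n = 1" using growing_word_1_later by blast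
    then show "\<exists>n\<ge>m. n \<in> ?X" by (intro exI[of _ n]) auto
  qed
  moreover have "finite (r ` ?X)"
    using V.run_in_states[OF r(1)] V.finite_states by (auto intro: finite_subset)
  ultimately obtain a where "a \<in> ?X" and inf: "infinite {n \<in> ?X. r n = r a}"
    using pigeonhole_infinite by blast
  then obtain b where b: "b > a" "r b = r a"
    unfolding infinite_nat_iff_unbounded by blast
  have a: "a \<ge> N" "?v a = 1" using \<open>a \<in> ?X\<close> by auto
  define p where "p = b - a"
  have p: "p > 0" "b = a + p" using b by (auto simp: p_def)
  \<comment> \<open>Time folded into the loop from \<open>a\<close> to \<open>b\<close>; the jump
    from \<open>b\<close> back to \<open>a\<close> is invisible to the run because
    \<open>r b = r a\<close>.\<close>
  define idx where "idx n = (if n < a then n else a + (n - a) mod p)" for n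
  have idx_Suc: "idx (Suc n) = Suc (idx n) \<or> idx (Suc n) = a \<and> Suc (idx n) = b" for n
  proof -
    consider "Suc n < a" | "Suc n = a" | "n \<ge> a" by linarith
    then show ?thesis
    proof cases
      case 3
      then have "idx (Suc n) = a + Suc (n - a) mod p" "idx n = a + (n - a) mod p"
        by (auto simp: idx_def Suc_diff_le)
      then show ?thesis using p by (auto simp: mod_Suc)
    qed (auto simp: idx_def)
  qed
  then have r_idx: "r (idx (Suc n)) = r (Suc (idx n))" for n
    using b(2) by metis
  define w where "w = ?v \<circ> idx"
  define s where "s = r \<circ> idx"
  have w: "is_word {0, 1} w" using v by (auto simp: is_word_def w_def)
  interpret W: pwa_word "{0, 1}" A w by unfold_locales (use A w in auto)
  have "idx 0 = 0" using p by (simp add: idx_def)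
  then have "is_run A w s"
    using r(1) by (auto simp: is_run_def w_def s_def r_idx)
  moreover have "1 / 2 < step_weight A w s n" if "n \<ge> a" for n
  proof -
    have "idx n \<ge> N" using that a(1) by (simp add: idx_def)
    then show ?thesis using N[of "idx n"] by (simp add: w_def s_def r_idx)
  qed
  ultimately have "1 / 2 < max_sem A w"
    unfolding W.max_sem_gt_iff eventually_sequentially by blast
  moreover have "pos_sem gap_pwa w = 0"
  proof (rule pos_sem_gap_periodic[OF w p(1)])
    show "w (n + p) = w n" if "n \<ge> a" for n
    proof -
      have "(n + p - a) mod p = (n - a) mod p" using that
        by (metis Nat.add_diff_assoc2 mod_add_self2)
      then show ?thesis using that by (simp add: w_def idx_def)
    qed
    show "w a = 1" using a(2) by (simp add: w_def idx_def)
  qed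
  ultimately show False using eq[OF w] by simp
qed

section \<open>Almost sure but not positive: infinitely many letters 0\<close>

definition escape_trans :: "nat \<Rightarrow> nat \<Rightarrow> nat pmf" where
  "escape_trans q \<sigma> = (if q = 2 \<and> \<sigma> = 0 then pmf_of_set {2, 3} else return_pmf q)"

text \<open>State 3 is absorbing and is entered with probability 1/2 on each letter 0, so escaping
  from state 2 is almost sure iff the letter 0 occurs infinitely often.\<close>

definition escape_pwa :: "nat pwa" where
  "escape_pwa = \<lparr>states = {2, 3}, init = return_pmf 2, trans = escape_trans,
     weight = (\<lambda>q \<sigma> q'. if q' = 2 then 0 else 1)\<rparr>"

lemma escape_pwa_simps [simp]:
  "states escape_pwa = {2, 3}" "init escape_pwa = return_pmf 2" "trans escape_pwa = escape_trans"
  "weight escape_pwa q \<sigma> q' = (if q' = 2 then 0 else 1)"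
  by (simp_all add: escape_pwa_def)

lemma escape_trans_simps [simp]:
  "escape_trans 2 \<sigma> = (if \<sigma> = 0 then pmf_of_set {2, 3} else return_pmf 2)"
  "escape_trans 3 \<sigma> = return_pmf 3"
  by (simp_all add: escape_trans_def)

lemma wf_escape_pwa: "wf_pwa {0, 1} escape_pwa"
  by (auto simp: wf_pwa_def)

locale escape_word =
  fixes w :: "nat \<Rightarrow> nat"
  assumes w: "is_word {0, 1} w"
begin

sublocale pwa_word "{0, 1}" escape_pwa w
  by unfold_locales (use w wf_escape_pwa in auto)

sublocale E: finite_chain "\<lambda>i q. escape_trans q (w i)" "{2, 3}" "\<lambda>_ _ q'. q' \<noteq> 2"
  by unfold_locales (auto split: if_splits)

text \<open>The complementary safety condition measures the paths that never escape.\<close>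

sublocale Z: finite_chain "\<lambda>i q. escape_trans q (w i)" "{2, 3}" "\<lambda>_ _ q'. q' = 2"
  by unfold_locales (auto split: if_splits)

lemma as_sem_escape: "as_sem escape_pwa w = (if E.ev_safe 0 2 = 1 then 1 else 0)"
proof -
  have "measure (run_measure escape_pwa w) {r. \<forall>\<^sub>F n in sequentially. r (Suc n) \<noteq> 2} = E.ev_safe 0 2"
    by (simp add: run_measure_eq_chain E.ev_safe_def chain_from_def)
  then show ?thesis
    using two_valued_sem(1)[OF pwa_word_axioms, of 0 1 "\<lambda>_ _ q'. q' = 2"] by simp
qed

lemma ev_safe_3: "E.ev_safe n 3 = 1"
proof -
  have [simp]: "{q'. q' = 3 \<and> (q' = 2 \<or> q' = 3)} = {3 :: nat}" by auto
  have "E.safe_upto k n 3 = 1" for k n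
    by (induction k arbitrary: n) (simp_all add: E.safe_upto_Suc)
  then have "E.safe n 3 = 1"
    using E.safe_upto_tendsto[of n 3] by (simp add: LIMSEQ_const_iff)
  then show ?thesis
    using E.safe_le_ev_safe[of n 3] prob_space.prob_le_1[OF prob_space_chain_from]
    by (auto simp: E.ev_safe_def intro!: antisym)
qed

lemma ev_safe_step_2: "1 - E.ev_safe n 2 = (if w n = 0 then 1/2 else 1) * (1 - E.ev_safe (Suc n) 2)"
  using ev_safe_3[of "Suc n"] E.ev_safe_step[of 2 n]
  by (simp add: field_simps)

text \<open>As state 3 is absorbing, \<open>1 - E.ev_safe n 2\<close> is the probability of staying
  in state 2 forever, to which each letter 0 contributes a factor 1/2.\<close>

lemma ev_safe_product:
  "1 - E.ev_safe 0 2 = (\<Prod>i<n. if w i = 0 then 1/2 else 1) * (1 - E.ev_safe n 2)"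
proof (induction n)
  case (Suc n)
  then show ?case using ev_safe_step_2[of n] by simp
qed simp

lemma ev_safe_0_eq_1:
  assumes "\<exists>\<^sub>\<infinity>n. w n = 0"
  shows "E.ev_safe 0 2 = 1"
proof -
  have le1: "0 \<le> 1 - E.ev_safe n q" "1 - E.ev_safe n q \<le> 1" for n q
    using prob_space.prob_le_1[OF prob_space_chain_from] by (simp_all add: E.ev_safe_def)
  have "\<exists>n. (\<Prod>i<n. if w i = 0 then 1/2 else 1 :: real) \<le> (1/2) ^ j" for j
  proof (induction j)
    case (Suc j)
    then obtain n where n: "(\<Prod>i<n. if w i = 0 then 1/2 else 1 :: real) \<le> (1/2) ^ j" by blast
    obtain m where m: "m \<ge> n" "w m = 0" using assms by (auto simp: INFM_nat_le)
    have "(\<Prod>i<Suc l. if w i = 0 then 1/2 else 1 :: real) \<le> (\<Prod>i<l. if w i = 0 then 1/2 else 1)" for l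
      by (simp add: prod_nonneg)
    from lift_Suc_antimono_le[where f="\<lambda>m. \<Prod>i<m. if w i = 0 then 1/2 else 1", OF this m(1)]
    have "(\<Prod>i<m. if w i = 0 then 1/2 else 1 :: real) \<le> (\<Prod>i<n. if w i = 0 then 1/2 else 1)" .
    then have "(\<Prod>i<Suc m. if w i = 0 then 1/2 else 1 :: real) \<le> (1/2) ^ Suc j"
      using n m(2) by simp
    then show ?case by blast
  qed (auto intro: exI[of _ 0])
  moreover have "1 - E.ev_safe 0 2 \<le> (\<Prod>i<n. if w i = 0 then 1/2 else 1)" for n
    unfolding ev_safe_product[of n] by (intro mult_left_le le1 prod_nonneg) auto
  ultimately have "1 - E.ev_safe 0 2 \<le> (1/2) ^ j" for j
    by (meson order_trans)
  moreover have "(\<lambda>j. (1/2 :: real) ^ j) \<longlonglongrightarrow> 0" by (intro LIMSEQ_realpow_zero) auto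
  ultimately have "1 - E.ev_safe 0 2 \<le> 0" by (intro LIMSEQ_le_const) auto
  with le1(1)[of 0 2] show ?thesis by simp
qed

text \<open>After the last letter 0 state 2 is never left, and it is still occupied at that time
  with positive probability.\<close>

lemma ev_safe_0_less_1:
  assumes "\<forall>\<^sub>\<infinity>n. w n \<noteq> 0"
  shows "E.ev_safe 0 2 < 1"
proof -
  obtain N where N: "\<And>n. n \<ge> N \<Longrightarrow> w n \<noteq> 0" using assms by (auto simp: MOST_nat_le)
  have "Z.safe_upto k n 2 = 1" if "n \<ge> N" for k n
    using that N by (induction k arbitrary: n) (simp_all add: Z.safe_upto_Suc)
  then have "Z.safe N 2 = 1"
    using Z.safe_upto_tendsto[of N 2] by (simp add: LIMSEQ_const_iff)
  interpret prob_space "chain_from (\<lambda>i q. escape_trans q (w i)) N 2" by (rule prob_space_chain_from)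
  have meas: "{r :: nat \<Rightarrow> nat. \<forall>i. r (Suc i) = 2} \<in> sets path_space"
    "{r :: nat \<Rightarrow> nat. \<forall>\<^sub>F i in sequentially. r (Suc i) \<noteq> 2} \<in> sets path_space"
    by (rule Collect_in_path_space, measurable) (rule Collect_in_path_space, rule pred_eventually_step)
  have "E.ev_safe N 2 \<le> prob (UNIV - {r. \<forall>i. r (Suc i) = 2})"
    unfolding E.ev_safe_def using meas by (intro finite_measure_mono) (auto simp: eventually_sequentially)
  also have "\<dots> = 0"
    using \<open>Z.safe N 2 = 1\<close> prob_compl[of "{r. \<forall>i. r (Suc i) = 2}"] meas by (simp add: Z.safe_def)
  finally have "E.ev_safe N 2 \<le> 0" .
  moreover have "(\<Prod>i<N. if w i = 0 then 1/2 else 1 :: real) > 0" by (intro prod_pos) auto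
  ultimately have "1 - E.ev_safe 0 2 > 0" unfolding ev_safe_product[of N] by (intro mult_pos_pos) auto
  then show ?thesis by simp
qed

end

lemma as_sem_escape_pwa:
  assumes "is_word {0, 1} w"
  shows "as_sem escape_pwa w = (if \<exists>\<^sub>\<infinity>n. w n = 0 then 1 else 0)"
proof -
  interpret escape_word w by unfold_locales fact
  show ?thesis
  proof (cases "\<exists>\<^sub>\<infinity>n. w n = 0")
    case False
    then have "E.ev_safe 0 2 \<noteq> 1" using ev_safe_0_less_1 by (simp only: not_INFM) simp
    with False show ?thesis by (simp only: as_sem_escape if_False)
  qed (simp add: as_sem_escape ev_safe_0_eq_1)
qed

text \<open>On a constant block, safety over \<open>k\<close> steps depends neither on the time nor
  on the rest of the word. Hence \<open>N\<close> can be fixed before the word that defeats the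
  automaton is built.\<close>

primrec const_safe :: "'a pwa \<Rightarrow> rat \<Rightarrow> 'a \<Rightarrow> nat \<Rightarrow> nat \<Rightarrow> real" where
  "const_safe A u \<sigma> 0 q = 1"
| "const_safe A u \<sigma> (Suc k) q = (\<Sum>q'\<in>states A. pmf (trans A q \<sigma>) q' *
     (if u < weight A q \<sigma> q' then const_safe A u \<sigma> k q' else 0))"

lemma (in pwa_word) safe_upto_const:
  assumes "q \<in> states A" "\<And>i. i < k \<Longrightarrow> w (n + i) = \<sigma>"
  shows "A.safe_upto u k n q = const_safe A u \<sigma> k q"
  using assms
proof (induction k arbitrary: n q)
  case (Suc k)
  have "w n = \<sigma>" using Suc.prems(2)[of 0] by simp
  moreover have "A.safe_upto u k (Suc n) q' = const_safe A u \<sigma> k q'" if "q' \<in> states A" for q'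
    using Suc.IH[of q' "Suc n"] Suc.prems(2)[of "Suc _"] that by simp
  ultimately show ?case
    by (auto simp: A.safe_upto_Suc[OF Suc.prems(1)] intro!: sum.cong)
qed simp

lemma reach_cong_word:
  assumes A: "pwa_word \<Sigma> A w" "pwa_word \<Sigma> A w'" and eq: "\<And>i. i < n \<Longrightarrow> w i = w' i"
  shows "pwa_word.reachable A w n = pwa_word.reachable A w' n"
proof -
  interpret W: pwa_word \<Sigma> A w by fact
  interpret W': pwa_word \<Sigma> A w' by fact
  show ?thesis using eq by (induction n) simp_all
qed

text \<open>If a positive automaton \<open>A\<close> recognized the words with infinitely many letters 0, every state
  reachable on some prefix would have probability 0 to remain safe on the constant tail 1, so some
  number \<open>N\<close> of letters 1 would make all these probabilities less than 1/2, and \<open>A\<close> would reject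
  the word \<open>(0 1^N)^\<omega>\<close>.\<close>

theorem not_reducible_as_pos: "\<not> reducible {0, 1 :: nat} as_sem pos_sem"
proof
  assume "reducible {0, 1 :: nat} as_sem pos_sem"
  then obtain A where A: "wf_pwa {0, 1} A"
    and eq: "\<And>w. is_word {0, 1 :: nat} w \<Longrightarrow> as_sem escape_pwa w = pos_sem A w"
    unfolding reducible_def using wf_escape_pwa by blast
  have pw: "pwa_word {0, 1} A w" if "is_word {0, 1} w" for w
    by unfold_locales (use A that in auto)
  \<comment> \<open>Collected over all words and times, so that \<open>N\<close> also works for the
    states reached on the word built from \<open>N\<close>.\<close>
  define Rch where "Rch = {q. \<exists>w n. is_word {0, 1} w \<and> q \<in> finite_chain.reach (\<lambda>i q. trans A q (w i)) (set_pmf (init A)) n}"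
  have Rch_subset: "Rch \<subseteq> states A"
    using pwa_word.reachable_subset[OF pw] by (auto simp: Rch_def)
  have lim: "(\<lambda>k. const_safe A (1/2) 1 k q) \<longlonglongrightarrow> 0" if q: "q \<in> Rch" for q
  proof -
    obtain v n where v: "is_word {0, 1} v" and
      qn: "q \<in> finite_chain.reach (\<lambda>i q. trans A q (v i)) (set_pmf (init A)) n"
      using q by (auto simp: Rch_def)
    \<comment> \<open>Keeping the prefix keeps \<open>q\<close> reachable, and the constant tail
      leaves finitely many letters 0, hence value 0.\<close>
    define w where "w i = (if i < n then v i else 1)" for i
    have w: "is_word {0, 1} w" using v by (auto simp: is_word_def w_def)
    interpret pwa_word "{0, 1}" A w by (rule pw[OF w])
    have q: "q \<in> reachable n"
      using qn reach_cong_word[OF pw[OF v] pw[OF w], of n] by (simp add: w_def)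
    have "\<not> (\<exists>\<^sub>\<infinity>i. w i = 0)"
      unfolding INFM_nat_le by (auto simp: w_def intro!: exI[of _ n])
    then have "pos_sem A w = 0"
      using eq[OF w] as_sem_escape_pwa[OF w] by (simp only: if_False)
    then have "\<not> real_of_rat (1/2) < pos_sem A w" by (simp add: of_rat_divide)
    then have "A.safe (1/2) n q = 0"
      using q A.safe_nonneg[of "1/2" n q] unfolding pos_sem_gt_iff by (meson antisym not_less)
    moreover have "A.safe_upto (1/2) k n q = const_safe A (1/2) 1 k q" for k
      using q reachable_subset by (intro safe_upto_const) (auto simp: w_def)
    ultimately show ?thesis using A.safe_upto_tendsto[of "1/2" n q] by simp
  qed
  have "finite Rch" using A Rch_subset by (auto simp: wf_pwa_def intro: finite_subset)
  then have "\<forall>\<^sub>F k in sequentially. \<forall>q\<in>Rch. const_safe A (1/2) 1 k q < 1/2"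
    using lim by (intro eventually_ball_finite ballI order_tendstoD(2)[OF lim]) auto
  then obtain N where N: "\<And>q. q \<in> Rch \<Longrightarrow> const_safe A (1/2) 1 N q < 1/2"
    by (auto simp: eventually_sequentially)
  define w where "w i = (if i mod Suc N = 0 then 0 else 1 :: nat)" for i
  have w: "is_word {0, 1} w" by (auto simp: is_word_def w_def)
  interpret pwa_word "{0, 1}" A w by (rule pw[OF w])
  have "\<exists>\<^sub>\<infinity>i. w i = 0"
    unfolding INFM_nat_le
  proof
    fix m
    show "\<exists>n\<ge>m. w n = 0"
    proof (intro exI conjI)
      show "w (m * Suc N) = 0" unfolding w_def mod_mult_self2_is_0 by simp
    qed simp
  qed
  then have "real_of_rat (1/2) < pos_sem A w"
    using eq[OF w] as_sem_escape_pwa[OF w] by (simp add: of_rat_divide)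
  then obtain n q where nq: "q \<in> reachable n" "A.safe (1/2) n q > 0"
    unfolding pos_sem_gt_iff by blast
  obtain M where M: "\<And>m. m \<ge> M \<Longrightarrow> \<exists>q\<in>reachable m. A.safe (1/2) m q > 1/2"
    using A.safe_tends_to_1[OF init_subset nq, of "1/2"] by auto
  \<comment> \<open>The position right after a letter 0, late enough for \<open>M\<close>: the next
    \<open>N\<close> letters are all 1.\<close>
  define m where "m = M * Suc N + 1"
  have "m \<ge> M" by (simp add: m_def)
  then obtain p where p: "p \<in> reachable m" "A.safe (1/2) m p > 1/2" using M by blast
  have "A.safe (1/2) m p \<le> A.safe_upto (1/2) N m p" by (rule A.safe_le_safe_upto)
  also have "\<dots> = const_safe A (1/2) 1 N p"
  proof (rule safe_upto_const)
    show "p \<in> states A" using p(1) reachable_subset by auto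
    show "w (m + i) = 1" if "i < N" for i
    proof -
      have "m + i = Suc i + M * Suc N" by (simp add: m_def)
      then have "(m + i) mod Suc N = Suc i mod Suc N" by (simp only: mod_mult_self1)
      then show ?thesis using that by (simp add: w_def)
    qed
  qed
  also have "\<dots> < 1/2" using p(1) w by (intro N) (auto simp: Rch_def)
  finally show False using p(2) by simp
qed

theorem theorem3:
  shows "(\<forall>\<Sigma>::'a set. finite \<Sigma> \<longrightarrow> reducible \<Sigma> max_sem pos_sem) \<and>
         (\<forall>\<Sigma>::'a set. finite \<Sigma> \<longrightarrow> reducible \<Sigma> pos_sem as_sem) \<and>
         (\<exists>\<Sigma>::nat set. finite \<Sigma> \<and> \<not> reducible \<Sigma> pos_sem max_sem) \<and>
         (\<exists>\<Sigma>::nat set. finite \<Sigma> \<and> \<not> reducible \<Sigma> as_sem pos_sem)"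
  using reducible_max_pos reducible_pos_as not_reducible_pos_max not_reducible_as_pos
  by (intro conjI allI impI exI[of _ "{0, 1}"]) auto

end
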